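(* Let $H,A,(S_t)_{t\ge0},W,\alpha,\sigma,\rho$ be as described in the context, and let $K\subset H$ be a nonempty closed subset. Suppose that for some $\epsilon>0$ $$\liminf_{t\downarrow 0}\frac1t d_K\big(S_t h+t(\alpha(h)-\rho(h)+\sigma(h)u)\big)\le\epsilon\quad\text{for all } h\in K \text{ and } u\in U_0.$$ Then for all $x_0\in H$ and $\delta>0$ there exist a time horizon $S\in(0,T]$ and an open neighborhood $U(x_0,\delta)\subset H$ of $x_0$ such that $$\mathbb{E}\big[d_K(X(t;x))^2\big]^{1/2}\le\delta,\quad (t,x)\in[0,S]\times(K\cap U(x_0,\delta)).$$
   Context: $\mathbb{R}_+=[0,\infty)$. Fix $T>0$ and a filtered probability space $(\Omega,\mathcal{F},(\mathcal{F}_t)_{t\in[0,T]},\mathbb{P})$ satisfying the usual conditions. $H$ is a separable Hilbert space and $A$ generates a $C_0$-semigroup $(S_t)_{t\ge 0}$ on $H$ with $\|S_t\|\le e^{\beta t}$, $t\ge 0$, for some $\beta\in\mathbb{R}_+$. $U$ is a separable Hilbert space and $W$ is a $U$-valued $Q$-Wiener process, where $Q\in L(U)$ is nuclear, self-adjoint and positive definite; $\{e_j\}_{j\in\mathbb{N}}$ is an orthonormal basis of $U$ and $\lambda_j>0$ with $\sum_j\lambda_j<\infty$ and $Qe_j=\lambda_je_j$. $U_0:=Q^{1/2}(U)$ is the Hilbert space with inner product $\langle u,v\rangle_{U_0}=\langle Q^{-1/2}u,Q^{-1/2}v\rangle_U$ and orthonormal basis $g_j:=\sqrt{\lambda_j}e_j$;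 $L_2^0(H)$ is the space of Hilbert-Schmidt operators from $U_0$ to $H$, and $\Sigma^j:=\Sigma g_j$ for $\Sigma\in L_2^0(H)$. The coefficients $\alpha:H\to H$ and $\sigma:H\to L_2^0(H)$ are Lipschitz continuous, and $\sigma^j:=\sigma(\cdot)g_j\in C_b^2(H)$ for each $j$ (twice continuously differentiable, bounded with bounded first and second derivatives). With $\kappa_{j,1}:=\sup_h\|\sigma^j(h)\|$, $\kappa_{j,2}:=\sup_h\|D\sigma^j(h)\|$, $\kappa_{j,3}:=\sup_h\|D^2\sigma^j(h)\|$ and $L_j:=\frac12(\kappa_{j,2}^2+\kappa_{j,1}\kappa_{j,3})$, assume $\sum_{j=1}^\infty L_j<\infty$, and assume that for each $h\in H$ the limit $\rho(h):=\lim_{r\to\infty}\frac12\sum_{j=1}^r D\sigma^j(h)\sigma^j(h)$ exists; this defines $\rho:H\to H$. For $x\in H$, $X(\cdot;x)$ is the mild solution of $dX(t)=(AX(t)+\alpha(X(t)))dt+\sigma(X(t))dW(t)$, $X(0)=x$, i.e. the continuous adapted $H$-valued process with, $\mathbb{P}$-almost surely, $X(t;x)=S_tx+\int_0^tS_{t-s}\alpha(X(s;x))ds+\int_0^tS_{t-s}\sigma(X(s;x))dW(s)$ for $t\in[0,T]$. $d_K(x):=\inf_{y\in K}\|x-y\|$. *)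

theory Defs
  imports "HOL-Probability.Probability"
begin

text \<open>
  A separable Hilbert space is a type of class \<open>real_inner\<close>, \<open>complete_space\<close> and
  \<open>second_countable_topology\<close>.  Elements of the probability space have type \<open>'w\<close>, the state
  space \<open>H\<close> is the type \<open>'h\<close> and the noise space \<open>U\<close> is the type \<open>'u\<close>.
\<close>

section \<open>Semigroups\<close>

definition C0_semigroup :: "(real \<Rightarrow> 'h::real_normed_vector \<Rightarrow>\<^sub>L 'h) \<Rightarrow> bool" where
  "C0_semigroup S \<longleftrightarrow>
     S 0 = id_blinfun \<and>
     (\<forall>s\<ge>0. \<forall>t\<ge>0. S (s + t) = S s o\<^sub>L S t) \<and>
     (\<forall>x. ((\<lambda>t. S t x) \<longlongrightarrow> x) (at_right 0))"

definition is_generator ::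
  "(real \<Rightarrow> 'h::real_normed_vector \<Rightarrow>\<^sub>L 'h) \<Rightarrow> 'h set \<Rightarrow> ('h \<Rightarrow> 'h) \<Rightarrow> bool" where
  "is_generator S domA A \<longleftrightarrow>
     domA = {x. \<exists>y. ((\<lambda>t. (1 / t) *\<^sub>R (S t x - x)) \<longlongrightarrow> y) (at_right 0)} \<and>
     (\<forall>x\<in>domA. ((\<lambda>t. (1 / t) *\<^sub>R (S t x - x)) \<longlongrightarrow> A x) (at_right 0))"

section \<open>Functions of class \<open>C\<^sub>b\<^sup>2\<close>\<close>

text \<open>The Frechet derivative as a map into the normed space of bounded linear operators, so that
  it can be differentiated again.\<close>

definition Dop :: "('a::real_normed_vector \<Rightarrow> 'b::real_normed_vector) \<Rightarrow> 'a \<Rightarrow> 'a \<Rightarrow>\<^sub>L 'b" where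
  "Dop f x = Blinfun (frechet_derivative f (at x))"

definition Cb2 :: "('a::real_normed_vector \<Rightarrow> 'b::real_normed_vector) \<Rightarrow> bool" where
  "Cb2 f \<longleftrightarrow>
     (\<forall>x. f differentiable at x) \<and>
     (\<forall>x. Dop f differentiable at x) \<and>
     continuous_on UNIV (Dop (Dop f)) \<and>
     bounded (range f) \<and> bounded (range (Dop f)) \<and> bounded (range (Dop (Dop f)))"

text \<open>The constant \<open>L = (\<kappa>\<^sub>2\<^sup>2 + \<kappa>\<^sub>1 \<kappa>\<^sub>3) / 2\<close> built from the suprema of \<open>f\<close>, \<open>Df\<close> and \<open>D\<^sup>2f\<close>.\<close>

definition L_const :: "('a::real_normed_vector \<Rightarrow> 'b::real_normed_vector) \<Rightarrow> real" where
  "L_const f =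
     ((SUP x. norm (Dop f x))\<^sup>2 + (SUP x. norm (f x)) * (SUP x. norm (Dop (Dop f) x))) / 2"

section \<open>The covariance operator and the space \<open>L\<^sub>2\<^sup>0(H)\<close>\<close>

definition self_adjoint :: "('u::real_inner \<Rightarrow>\<^sub>L 'u) \<Rightarrow> bool" where
  "self_adjoint Q \<longleftrightarrow> (\<forall>u v. Q u \<bullet> v = u \<bullet> Q v)"

definition positive_definite :: "('u::real_inner \<Rightarrow>\<^sub>L 'u) \<Rightarrow> bool" where
  "positive_definite Q \<longleftrightarrow> (\<forall>u. u \<noteq> 0 \<longrightarrow> Q u \<bullet> u > 0)"

text \<open>Functionals are represented by vectors via the Riesz representation theorem.\<close>

definition nuclear :: "('u::real_inner \<Rightarrow>\<^sub>L 'u) \<Rightarrow> bool" where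
  "nuclear Q \<longleftrightarrow>
     (\<exists>a b :: nat \<Rightarrow> 'u. summable (\<lambda>n. norm (a n) * norm (b n)) \<and>
        (\<forall>u. (\<lambda>n. (a n \<bullet> u) *\<^sub>R b n) sums Q u))"

definition orthonormal_basis :: "(nat \<Rightarrow> 'u::real_inner) \<Rightarrow> bool" where
  "orthonormal_basis e \<longleftrightarrow>
     (\<forall>i j. e i \<bullet> e j = (if i = j then 1 else 0)) \<and> closure (span (range e)) = UNIV"

text \<open>\<open>Q\<^sup>1\<^sup>/\<^sup>2\<close>: the nonnegative self-adjoint square root of \<open>Q\<close>.\<close>

definition op_sqrt :: "('u::real_inner \<Rightarrow>\<^sub>L 'u) \<Rightarrow> 'u \<Rightarrow>\<^sub>L 'u" where
  "op_sqrt Q = (THE R. self_adjoint R \<and> (\<forall>u. R u \<bullet> u \<ge> 0) \<and> R o\<^sub>L R = Q)"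

definition U0 :: "('u::real_inner \<Rightarrow>\<^sub>L 'u) \<Rightarrow> 'u set" where
  "U0 Q = range (blinfun_apply (op_sqrt Q))"

definition U0_norm :: "('u::real_inner \<Rightarrow>\<^sub>L 'u) \<Rightarrow> 'u \<Rightarrow> real" where
  "U0_norm Q u = norm (inv (blinfun_apply (op_sqrt Q)) u)"

text \<open>Hilbert-Schmidt operators from \<open>U\<^sub>0\<close> to \<open>H\<close>, where \<open>g\<close> is an orthonormal basis of \<open>U\<^sub>0\<close>.
  An operator is a function on all of \<open>U\<close>, but only its values on the subspace \<open>U\<^sub>0\<close> matter.\<close>

definition L20 ::
  "('u::real_inner \<Rightarrow>\<^sub>L 'u) \<Rightarrow> (nat \<Rightarrow> 'u) \<Rightarrow> ('u \<Rightarrow> 'h::real_normed_vector) set" where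
  "L20 Q g =
     {\<Sigma>. (\<forall>u\<in>U0 Q. \<forall>v\<in>U0 Q. \<Sigma> (u + v) = \<Sigma> u + \<Sigma> v) \<and>
         (\<forall>c. \<forall>u\<in>U0 Q. \<Sigma> (c *\<^sub>R u) = c *\<^sub>R \<Sigma> u) \<and>
         (\<exists>C. \<forall>u\<in>U0 Q. norm (\<Sigma> u) \<le> C * U0_norm Q u) \<and>
         summable (\<lambda>j. (norm (\<Sigma> (g j)))\<^sup>2)}"

definition L20_norm :: "(nat \<Rightarrow> 'u) \<Rightarrow> ('u \<Rightarrow> 'h::real_normed_vector) \<Rightarrow> real" where
  "L20_norm g \<Sigma> = sqrt (\<Sum>j. (norm (\<Sigma> (g j)))\<^sup>2)"

section \<open>Filtered probability spaces and Wiener processes\<close>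

text \<open>All processes are indexed by \<open>real\<close>; only their values on \<open>[0,T]\<close> matter.\<close>

definition usual_filtration :: "'w measure \<Rightarrow> real \<Rightarrow> (real \<Rightarrow> 'w measure) \<Rightarrow> bool" where
  "usual_filtration M T F \<longleftrightarrow>
     prob_space M \<and>
     complete_measure M \<and>
     (\<forall>t\<in>{0..T}. subalgebra M (F t)) \<and>
     (\<forall>t\<in>{0..T}. \<forall>s\<in>{0..t}. sets (F s) \<subseteq> sets (F t)) \<and>
     null_sets M \<subseteq> sets (F 0) \<and>
     (\<forall>t\<in>{0..<T}. sets (F t) = (\<Inter>s\<in>{t<..T}. sets (F s)))"

text \<open>\<open>X\<close> is a centred Gaussian random variable with covariance operator \<open>Q\<close>: each \<open>\<langle>X,u\<rangle>\<close> has law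
  \<open>N(0, \<langle>Qu,u\<rangle>)\<close>, which is the Dirac measure at \<open>0\<close> if \<open>\<langle>Qu,u\<rangle> = 0\<close>.\<close>

definition gaussian_rv ::
  "'w measure \<Rightarrow> ('u::{real_inner,second_countable_topology} \<Rightarrow>\<^sub>L 'u) \<Rightarrow> ('w \<Rightarrow> 'u) \<Rightarrow> bool" where
  "gaussian_rv M Q X \<longleftrightarrow>
     X \<in> borel_measurable M \<and>
     (\<forall>u. if Q u \<bullet> u = 0 then AE \<omega> in M. X \<omega> \<bullet> u = 0
          else distributed M lborel (\<lambda>\<omega>. X \<omega> \<bullet> u) (normal_density 0 (sqrt (Q u \<bullet> u))))"

definition Q_Wiener ::
  "'w measure \<Rightarrow> real \<Rightarrow> (real \<Rightarrow> 'w measure) \<Rightarrow>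
   ('u::{real_inner,second_countable_topology} \<Rightarrow>\<^sub>L 'u) \<Rightarrow> (real \<Rightarrow> 'w \<Rightarrow> 'u) \<Rightarrow> bool" where
  "Q_Wiener M T F Q W \<longleftrightarrow>
     (\<forall>t\<in>{0..T}. W t \<in> borel_measurable (F t)) \<and>
     (AE \<omega> in M. W 0 \<omega> = 0) \<and>
     (AE \<omega> in M. continuous_on {0..T} (\<lambda>t. W t \<omega>)) \<and>
     (\<forall>t\<in>{0..T}. \<forall>s\<in>{0..t}.
        prob_space.indep_set M (sets (F s))
          (sets (vimage_algebra (space M) (\<lambda>\<omega>. W t \<omega> - W s \<omega>) borel)) \<and>
        gaussian_rv M ((t - s) *\<^sub>R Q) (\<lambda>\<omega>. W t \<omega> - W s \<omega>))"

section \<open>The stochastic integral\<close>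

definition predictable_sigma ::
  "'w measure \<Rightarrow> (real \<Rightarrow> 'w measure) \<Rightarrow> real \<Rightarrow> (real \<times> 'w) measure" where
  "predictable_sigma M F t =
     sigma ({0..t} \<times> space M)
       ({{0} \<times> A |A. A \<in> sets (F 0)} \<union>
        {{a<..b} \<times> A |a b A. 0 \<le> a \<and> a \<le> b \<and> b \<le> t \<and> A \<in> sets (F a)})"

text \<open>Elementary processes \<open>\<Sum>\<^bsub>k<n\<^esub> \<Phi>\<^sub>k 1\<^bsub>(\<tau>\<^sub>k, \<tau>\<^sub>k\<^sub>+\<^sub>1]\<^esub>\<close> on \<open>[0,t]\<close>, where \<open>\<Phi>\<^sub>k\<close> takes finitely many
  values in \<open>L(U,H)\<close> and is measurable at time \<open>\<tau>\<^sub>k\<close>.\<close>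

definition elementary ::
  "(real \<Rightarrow> 'w measure) \<Rightarrow> real \<Rightarrow> nat \<Rightarrow> (nat \<Rightarrow> real) \<Rightarrow>
   (nat \<Rightarrow> 'w \<Rightarrow> 'u::real_normed_vector \<Rightarrow>\<^sub>L 'h::real_normed_vector) \<Rightarrow> bool" where
  "elementary F t n \<tau> \<Phi> \<longleftrightarrow>
     0 \<le> \<tau> 0 \<and> \<tau> n \<le> t \<and>
     (\<forall>k<n. \<tau> k \<le> \<tau> (Suc k) \<and> simple_function (F (\<tau> k)) (\<Phi> k))"

definition elem_process ::
  "nat \<Rightarrow> (nat \<Rightarrow> real) \<Rightarrow> (nat \<Rightarrow> 'w \<Rightarrow> 'u::real_normed_vector \<Rightarrow>\<^sub>L 'h::real_normed_vector) \<Rightarrow>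
   real \<Rightarrow> 'w \<Rightarrow> 'u \<Rightarrow> 'h" where
  "elem_process n \<tau> \<Phi> s \<omega> u = (\<Sum>k<n. indicator {\<tau> k<..\<tau> (Suc k)} s *\<^sub>R \<Phi> k \<omega> u)"

definition elem_integral ::
  "(real \<Rightarrow> 'w \<Rightarrow> 'u) \<Rightarrow> nat \<Rightarrow> (nat \<Rightarrow> real) \<Rightarrow>
   (nat \<Rightarrow> 'w \<Rightarrow> 'u::real_normed_vector \<Rightarrow>\<^sub>L 'h::real_normed_vector) \<Rightarrow> 'w \<Rightarrow> 'h" where
  "elem_integral W n \<tau> \<Phi> \<omega> = (\<Sum>k<n. \<Phi> k \<omega> (W (\<tau> (Suc k)) \<omega> - W (\<tau> k) \<omega>))"

text \<open>\<open>I = \<integral>\<^sub>0\<^sup>t \<Psi>(s) dW(s)\<close> for a predictable \<open>L\<^sub>2\<^sup>0(H)\<close>-valued process \<open>\<Psi>\<close> with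
  \<open>\<integral>\<^sub>0\<^sup>t \<parallel>\<Psi>(s)\<parallel>\<^sup>2 ds < \<infinity>\<close> almost surely: there are elementary processes \<open>\<Phi>\<^sub>m\<close> such that
  \<open>\<integral>\<^sub>0\<^sup>t \<parallel>\<Phi>\<^sub>m(s) - \<Psi>(s)\<parallel>\<^sup>2 ds \<rightarrow> 0\<close> and \<open>\<integral>\<^sub>0\<^sup>t \<Phi>\<^sub>m(s) dW(s) \<rightarrow> I\<close> in probability.  As \<open>H\<close> is separable,
  measurability in \<open>L\<^sub>2\<^sup>0(H)\<close> amounts to measurability of all \<open>\<Psi>(s) g\<^sub>j\<close>.  The relation determines
  \<open>I\<close> up to almost sure equality.\<close>

definition has_stoch_integral ::
  "'w measure \<Rightarrow> (real \<Rightarrow> 'w measure) \<Rightarrow>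
   ('u::{real_inner,second_countable_topology} \<Rightarrow>\<^sub>L 'u) \<Rightarrow> (nat \<Rightarrow> 'u) \<Rightarrow> (real \<Rightarrow> 'w \<Rightarrow> 'u) \<Rightarrow> real \<Rightarrow>
   (real \<Rightarrow> 'w \<Rightarrow> 'u \<Rightarrow> 'h::{real_inner,second_countable_topology}) \<Rightarrow> ('w \<Rightarrow> 'h) \<Rightarrow> bool" where
  "has_stoch_integral M F Q g W t \<Psi> I \<longleftrightarrow>
     (\<forall>s\<in>{0..t}. \<forall>\<omega>\<in>space M. \<Psi> s \<omega> \<in> L20 Q g) \<and>
     (\<forall>j. (\<lambda>(s, \<omega>). \<Psi> s \<omega> (g j)) \<in> borel_measurable (predictable_sigma M F t)) \<and>
     I \<in> borel_measurable M \<and>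
     (\<exists>n \<tau> \<Phi>.
        (\<forall>m. elementary F t (n m) (\<tau> m) (\<Phi> m)) \<and>
        (\<forall>\<epsilon>>0. (\<lambda>m. measure M {\<omega> \<in> space M.
            (\<integral>\<^sup>+s\<in>{0..t}. (\<Sum>j. ennreal ((norm
                (elem_process (n m) (\<tau> m) (\<Phi> m) s \<omega> (g j) - \<Psi> s \<omega> (g j)))\<^sup>2)) \<partial>lborel)
              > ennreal \<epsilon>}) \<longlonglongrightarrow> 0) \<and>
        (\<forall>\<epsilon>>0. (\<lambda>m. measure M {\<omega> \<in> space M.
            norm (elem_integral W (n m) (\<tau> m) (\<Phi> m) \<omega> - I \<omega>) > \<epsilon>}) \<longlonglongrightarrow> 0))"

text \<open>Mild solutions on \<open>[0,T]\<close> of \<open>dX = (AX + \<alpha>(X)) dt + \<sigma>(X) dW\<close>, \<open>X(0) = x\<close>, where \<open>S\<close> is the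
  semigroup generated by \<open>A\<close>.  The process is continuous, hence the variation of constants formula
  for each \<open>t\<close> almost surely is the same as almost surely for all \<open>t\<close>.\<close>

definition mild_solution ::
  "'w measure \<Rightarrow> real \<Rightarrow> (real \<Rightarrow> 'w measure) \<Rightarrow>
   ('u::{real_inner,second_countable_topology} \<Rightarrow>\<^sub>L 'u) \<Rightarrow> (nat \<Rightarrow> 'u) \<Rightarrow> (real \<Rightarrow> 'w \<Rightarrow> 'u) \<Rightarrow>
   (real \<Rightarrow> 'h::{real_inner,complete_space,second_countable_topology} \<Rightarrow>\<^sub>L 'h) \<Rightarrow>
   ('h \<Rightarrow> 'h) \<Rightarrow> ('h \<Rightarrow> 'u \<Rightarrow> 'h) \<Rightarrow> 'h \<Rightarrow> (real \<Rightarrow> 'w \<Rightarrow> 'h) \<Rightarrow> bool" where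
  "mild_solution M T F Q g W S \<alpha> \<sigma> x X \<longleftrightarrow>
     (\<forall>t\<in>{0..T}. X t \<in> borel_measurable (F t)) \<and>
     (AE \<omega> in M. continuous_on {0..T} (\<lambda>t. X t \<omega>)) \<and>
     (\<forall>t\<in>{0..T}. has_stoch_integral M F Q g W t
        (\<lambda>s \<omega> u. S (t - s) (\<sigma> (X s \<omega>) u))
        (\<lambda>\<omega>. X t \<omega> - S t x - (LINT s:{0..t}|lborel. S (t - s) (\<alpha> (X s \<omega>)))))"

end

theory Submission
  imports Defs
begin

text \<open>
  A point \<open>x \<in> K\<close> satisfies \<open>d\<^sub>K(X(t;x)) \<le> \<parallel>X(t;x) - x\<parallel>\<close>, so it suffices that the mild solution is mean
  square continuous at time \<open>0\<close>, locally uniformly in the initial value.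

  No moment of \<open>X\<close> is known a priori.  Put \<open>Y(t) = \<integral>\<^sub>0\<^sup>t (1 + \<parallel>X(s)\<parallel>)\<^sup>2 ds\<close>, which dominates the squared norms
  of the drift and the quadratic variation of the stochastic convolution up to constants.
  Truncating the approximating elementary integrands once their quadratic variation exceeds a multiple
  of \<open>R\<close> gives \<open>E[\<parallel>X(t) - x\<parallel>\<^sup>2; Y(t) \<le> R] \<le> 3\<parallel>S\<^sub>t x - x\<parallel>\<^sup>2 + C u(t)\<close> with \<open>u(t) = E[min R (Y(t))]\<close>.  Since
  \<open>min R (Y(t)) \<le> \<integral>\<^sub>0\<^sup>t 1{Y(s) \<le> R} (1 + \<parallel>X(s)\<parallel>)\<^sup>2 ds\<close> and \<open>u\<close> is finite and increasing, it follows that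
  \<open>u(t) \<le> t (A + 2 C u(t))\<close>, hence \<open>u(t) \<le> 2 A t\<close> for \<open>4 C t \<le> 1\<close>, uniformly in \<open>R\<close>.  Let \<open>R \<rightarrow> \<infinity>\<close>.
\<close>

section \<open>Gaussian increments\<close>

text \<open>The integral against \<open>W\<close> is given only as a limit in probability, and its
  integrand has no moments to start with, so every second moment has to come from elementary
  integrands. These are cut according to accumulated quadratic variation, not according to the size
  of \<open>X\<close>: the cut can be made step by step without losing adaptedness, and where the
  budget is never exceeded the integral is unchanged path by path. No stopping times or maximal
  inequalities enter. This suits the stochastic convolution, whose integrand depends on the final
  time, so that each time is treated as a separate integral.

  The estimate of \<open>u\<close> is a Gronwall argument in which u(t) reappears on the right. It
  can be absorbed on the left only if it is finite, which the minimum with R secures; the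
  expectation of \<open>Y\<close> itself might be infinite and the inequality empty. The restriction
  to times with Y(s) at most R is forced because only there are moments of \<open>X\<close> under
  control, and continuity of \<open>Y\<close> in time ensures that the restricted integral still
  reaches the level R.\<close>

lemma orthonormal_basis_expansion:
  assumes "orthonormal_basis e"
  shows "(\<lambda>N. \<Sum>j<N. (w \<bullet> e j) *\<^sub>R e j) \<longlonglongrightarrow> w"
proof (rule LIMSEQ_I)
  fix r :: real assume r: "r > 0"
  have on: "e i \<bullet> e j = (if i = j then 1 else 0)" for i j
    using assms by (auto simp: orthonormal_basis_def)
  have "w \<in> closure (span (range e))" using assms by (simp add: orthonormal_basis_def)
  then obtain v where v: "v \<in> span (range e)" "dist v w < r"
    using r unfolding closure_approachable by blast
  obtain t c where t: "finite t" "t \<subseteq> range e" "v = (\<Sum>a\<in>t. c a *\<^sub>R a)"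
    using v(1) unfolding span_explicit by (auto intro: that)
  obtain J where J: "finite J" "t = e ` J" using finite_subset_image[OF t(1,2)] by (elim exE conjE) (rule that)
  obtain m where m: "J \<subseteq> {..<m}" using J(1) finite_nat_iff_bounded by blast
  show "\<exists>no. \<forall>n\<ge>no. norm ((\<Sum>j<n. (w \<bullet> e j) *\<^sub>R e j) - w) < r"
  proof (intro exI allI impI)
    fix n assume n: "m \<le> n"
    define P where "P = (\<Sum>j<n. (w \<bullet> e j) *\<^sub>R e j)"
    have "e j \<in> span (e ` {..<n})" if "j \<in> J" for j
      using that m n by (intro span_base) auto
    then have vs: "v \<in> span (e ` {..<n})"
      unfolding t(3) J(2) by (intro span_sum span_scale) blast
    have Ps: "P \<in> span (e ` {..<n})"
      unfolding P_def by (intro span_sum span_scale span_base) auto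
    have oe: "(w - P) \<bullet> e i = 0" if "i < n" for i
    proof -
      have "P \<bullet> e i = (\<Sum>j<n. if i = j then w \<bullet> e j else 0)"
        unfolding P_def inner_sum_left by (intro sum.cong) (auto simp: on)
      then show ?thesis using that by (simp add: inner_diff_left)
    qed
    \<comment> \<open>The projection \<open>P\<close> is at least as close to \<open>w\<close> as
      any combination \<open>v\<close> of the first \<open>n\<close> basis vectors. This turns
      density of the span into convergence of the Fourier sums.\<close>
    have "orthogonal (w - P) (P - v)"
    proof (rule orthogonal_to_span[of _ "e ` {..<n}"])
      show "P - v \<in> span (e ` {..<n})" using Ps vs by (rule span_diff)
      fix y assume "y \<in> e ` {..<n}"
      then show "orthogonal (w - P) y" using oe by (auto simp: orthogonal_def)
    qed
    then have "(norm (w - v))\<^sup>2 = (norm (w - P))\<^sup>2 + (norm (P - v))\<^sup>2"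
      using norm_add_Pythagorean[of "w - P" "P - v"] by simp
    then have "(norm (w - P))\<^sup>2 \<le> (norm (w - v))\<^sup>2" by simp
    then have "norm (w - P) \<le> norm (w - v)"
      by (rule power2_le_imp_le) simp
    then show "norm ((\<Sum>j<n. (w \<bullet> e j) *\<^sub>R e j) - w) < r"
      using v(2) unfolding P_def[symmetric] by (simp add: dist_norm norm_minus_commute)
  qed
qed

section \<open>Moments of Gaussian vectors and independence from the past\<close>

context prob_space
begin

lemma gaussian_rv_moments:
  fixes X :: "'a \<Rightarrow> 'u::{real_inner,second_countable_topology}"
  assumes "gaussian_rv M Q X" and pos: "Q u \<bullet> u \<ge> 0"
  shows "integrable M (\<lambda>\<omega>. X \<omega> \<bullet> u)" "expectation (\<lambda>\<omega>. X \<omega> \<bullet> u) = 0"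
    "integrable M (\<lambda>\<omega>. (X \<omega> \<bullet> u)\<^sup>2)" "expectation (\<lambda>\<omega>. (X \<omega> \<bullet> u)\<^sup>2) = Q u \<bullet> u"
proof -
  have [measurable]: "X \<in> borel_measurable M" using assms by (simp add: gaussian_rv_def)
  have *: "integrable M (\<lambda>\<omega>. X \<omega> \<bullet> u) \<and> expectation (\<lambda>\<omega>. X \<omega> \<bullet> u) = 0 \<and>
    integrable M (\<lambda>\<omega>. (X \<omega> \<bullet> u)\<^sup>2) \<and> expectation (\<lambda>\<omega>. (X \<omega> \<bullet> u)\<^sup>2) = Q u \<bullet> u"
  \<comment> \<open>A degenerate direction has no normal density; there the law is the Dirac measure
    at 0.\<close>
  proof (cases "Q u \<bullet> u = 0")
    case True
    then have ae: "AE \<omega> in M. X \<omega> \<bullet> u = 0" using assms by (auto simp: gaussian_rv_def)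
    have ae2: "AE \<omega> in M. (X \<omega> \<bullet> u)\<^sup>2 = 0" using ae by eventually_elim simp
    have "integrable M (\<lambda>\<omega>. X \<omega> \<bullet> u)" "integrable M (\<lambda>\<omega>. (X \<omega> \<bullet> u)\<^sup>2)"
      using ae ae2 integrable_cong_AE[of "\<lambda>\<omega>. X \<omega> \<bullet> u" M "\<lambda>_. 0"]
        integrable_cong_AE[of "\<lambda>\<omega>. (X \<omega> \<bullet> u)\<^sup>2" M "\<lambda>_. 0"] by simp_all
    with ae ae2 True show ?thesis by (simp add: integral_eq_zero_AE)
  next
    case False
    define s where "s = sqrt (Q u \<bullet> u)"
    have s: "s > 0" using pos False by (simp add: s_def)
    have D: "distributed M lborel (\<lambda>\<omega>. X \<omega> \<bullet> u) (normal_density 0 s)"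
      using assms False by (auto simp: gaussian_rv_def s_def)
    have "integrable M (\<lambda>\<omega>. X \<omega> \<bullet> u)"
      using distributed_integrable[OF D, of "\<lambda>x. x"] integrable_normal_moment[OF s, of 0 1] by simp
    moreover have "expectation (\<lambda>\<omega>. X \<omega> \<bullet> u) = 0" by (rule normal_distributed_expectation[OF s D])
    moreover have "integrable M (\<lambda>\<omega>. (X \<omega> \<bullet> u)\<^sup>2)"
      using distributed_integrable[OF D, of "\<lambda>x. x\<^sup>2"] integrable_normal_moment[OF s, of 0 2] by simp
    moreover have "variance (\<lambda>\<omega>. X \<omega> \<bullet> u) = s\<^sup>2" by (rule normal_distributed_variance[OF s D])
    ultimately show ?thesis using pos by (simp add: s_def)
  qed
  from * show "integrable M (\<lambda>\<omega>. X \<omega> \<bullet> u)" "expectation (\<lambda>\<omega>. X \<omega> \<bullet> u) = 0"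
    "integrable M (\<lambda>\<omega>. (X \<omega> \<bullet> u)\<^sup>2)" "expectation (\<lambda>\<omega>. (X \<omega> \<bullet> u)\<^sup>2) = Q u \<bullet> u" by auto
qed

text \<open>Polarization: only laws of single functionals are given, so the mixed moment is read off
  from the directions \<open>u\<close>, \<open>v\<close> and \<open>u + v\<close>. Self-adjointness
  makes the two cross terms equal.\<close>

lemma gaussian_rv_covariance:
  fixes X :: "'a \<Rightarrow> 'u::{real_inner,second_countable_topology}"
  assumes G: "gaussian_rv M Q X" and pos: "\<And>u. Q u \<bullet> u \<ge> 0" and sa: "self_adjoint Q"
  shows "integrable M (\<lambda>\<omega>. (X \<omega> \<bullet> u) * (X \<omega> \<bullet> v))"
    "expectation (\<lambda>\<omega>. (X \<omega> \<bullet> u) * (X \<omega> \<bullet> v)) = Q u \<bullet> v"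
proof -
  note m = gaussian_rv_moments[OF G pos]
  have eq: "(X \<omega> \<bullet> u) * (X \<omega> \<bullet> v) = ((X \<omega> \<bullet> (u + v))\<^sup>2 - (X \<omega> \<bullet> u)\<^sup>2 - (X \<omega> \<bullet> v)\<^sup>2) / 2" for \<omega>
    by (simp add: inner_add_right power2_eq_square algebra_simps)
  show "integrable M (\<lambda>\<omega>. (X \<omega> \<bullet> u) * (X \<omega> \<bullet> v))"
    unfolding eq using m by simp
  have "Q u \<bullet> v = Q v \<bullet> u" using sa by (metis inner_commute self_adjoint_def)
  moreover have "expectation (\<lambda>\<omega>. (X \<omega> \<bullet> u) * (X \<omega> \<bullet> v)) = (Q (u + v) \<bullet> (u + v) - Q u \<bullet> u - Q v \<bullet> v) / 2"
    unfolding eq by (simp add: m)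
  ultimately show "expectation (\<lambda>\<omega>. (X \<omega> \<bullet> u) * (X \<omega> \<bullet> v)) = Q u \<bullet> v"
    by (simp add: blinfun.add_right inner_add_left inner_add_right)
qed

text \<open>A Wiener process supplies independence of sigma-algebras, whereas the product rule for
  expectations concerns random variables. The passage is monotonicity: the sigma-algebra generated
  by \<open>Z\<close> lies in \<open>N\<close>, and that of \<open>h\<close> after \<open>Y\<close>
  lies in the one generated by \<open>Y\<close>.\<close>

lemma indep_subalgebra_expectation_mult:
  fixes Z :: "'a \<Rightarrow> real" and h :: "'b::topological_space \<Rightarrow> real"
  assumes ind: "indep_set (sets N) (sets (vimage_algebra (space M) Y borel))"
    and sp: "space N = space M"
    and N: "subalgebra M N"
    and Y: "Y \<in> borel_measurable M" and h: "h \<in> borel_measurable borel"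
    and Z: "Z \<in> borel_measurable N"
    and int: "integrable M Z" "integrable M (\<lambda>\<omega>. h (Y \<omega>))"
  shows "integrable M (\<lambda>\<omega>. Z \<omega> * h (Y \<omega>))"
    "expectation (\<lambda>\<omega>. Z \<omega> * h (Y \<omega>)) = expectation Z * expectation (\<lambda>\<omega>. h (Y \<omega>))"
proof -
  have [measurable]: "Y \<in> borel_measurable M" "h \<in> borel_measurable borel" by (fact Y, fact h)
  have ZM[measurable]: "Z \<in> borel_measurable M" by (rule measurable_from_subalg[OF N Z])
  have hY: "(\<lambda>\<omega>. h (Y \<omega>)) \<in> borel_measurable (vimage_algebra (space M) Y borel)"
    by (rule measurable_compose[OF measurable_vimage_algebra1 h]) simp
  have "indep_var borel Z borel (\<lambda>\<omega>. h (Y \<omega>))"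
    unfolding indep_var_eq
  proof (intro conjI)
    show "indep_set (sigma_sets (space M) {Z -` A \<inter> space M |A. A \<in> sets borel})
     (sigma_sets (space M) {(\<lambda>\<omega>. h (Y \<omega>)) -` A \<inter> space M |A. A \<in> sets borel})"
      using ind unfolding indep_set_def
    proof (rule indep_sets_mono_sets)
      fix i :: bool
      show "(case i of True \<Rightarrow> sigma_sets (space M) {Z -` A \<inter> space M |A. A \<in> sets borel}
          | False \<Rightarrow> sigma_sets (space M) {(\<lambda>\<omega>. h (Y \<omega>)) -` A \<inter> space M |A. A \<in> sets borel})
         \<subseteq> (case i of True \<Rightarrow> sets N | False \<Rightarrow> sets (vimage_algebra (space M) Y borel))"
      proof (cases i)
        case True
        have "sigma_sets (space N) {Z -` A \<inter> space N |A. A \<in> sets borel} \<subseteq> sets N"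
          by (rule sets.sigma_sets_subset) (auto intro: measurable_sets[OF Z])
        then show ?thesis using True by (simp add: sp)
      next
        case False
        let ?V = "vimage_algebra (space M) Y borel"
        have "sigma_sets (space ?V) {(\<lambda>\<omega>. h (Y \<omega>)) -` A \<inter> space ?V |A. A \<in> sets borel} \<subseteq> sets ?V"
          by (rule sets.sigma_sets_subset) (auto intro: measurable_sets[OF hY] simp del: space_vimage_algebra)
        then show ?thesis using False by simp
      qed
    qed
  qed measurable
  from indep_var_integrable[OF this int] indep_var_lebesgue_integral[OF this int]
  show "integrable M (\<lambda>\<omega>. Z \<omega> * h (Y \<omega>))"
    "expectation (\<lambda>\<omega>. Z \<omega> * h (Y \<omega>)) = expectation Z * expectation (\<lambda>\<omega>. h (Y \<omega>))"
    by auto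
qed

end

section \<open>The isometry for elementary integrands\<close>

locale wiener_integral =
  fixes M :: "'w measure" and T :: real and F :: "real \<Rightarrow> 'w measure"
    and Q :: "'u::{real_inner,second_countable_topology} \<Rightarrow>\<^sub>L 'u"
    and e :: "nat \<Rightarrow> 'u" and ev :: "nat \<Rightarrow> real" and g :: "nat \<Rightarrow> 'u" and W :: "real \<Rightarrow> 'w \<Rightarrow> 'u"
  assumes filtration: "usual_filtration M T F"
    and Q_self_adjoint: "self_adjoint Q"
    and Q_positive: "positive_definite Q"
    and basis: "orthonormal_basis e"
    and ev_pos: "\<And>j. ev j > 0"
    and Q_e: "\<And>j. Q (e j) = ev j *\<^sub>R e j"
    and g_eq: "\<And>j. g j = sqrt (ev j) *\<^sub>R e j"
    and wiener: "Q_Wiener M T F Q W"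
begin

sublocale prob_space M
  using filtration by (simp add: usual_filtration_def)

lemma F_subalgebra: "0 \<le> s \<Longrightarrow> s \<le> T \<Longrightarrow> subalgebra M (F s)"
  using filtration by (simp add: usual_filtration_def)

lemma space_F: "0 \<le> s \<Longrightarrow> s \<le> T \<Longrightarrow> space (F s) = space M"
  using F_subalgebra by (simp add: subalgebra_def)

lemma F_mono: "0 \<le> s \<Longrightarrow> s \<le> t \<Longrightarrow> t \<le> T \<Longrightarrow> subalgebra (F t) (F s)"
  using filtration F_subalgebra[of s] F_subalgebra[of t]
  by (auto simp: usual_filtration_def subalgebra_def)

lemma W_measurable_F: "0 \<le> t \<Longrightarrow> t \<le> T \<Longrightarrow> W t \<in> borel_measurable (F t)"
  using wiener by (simp add: Q_Wiener_def)

lemma W_measurable: "0 \<le> t \<Longrightarrow> t \<le> T \<Longrightarrow> W t \<in> borel_measurable M"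
  using measurable_from_subalg[OF F_subalgebra W_measurable_F] by blast

lemma increment_moments:
  assumes st: "0 \<le> s" "s \<le> t" "t \<le> T"
  defines "b \<equiv> \<lambda>j \<omega>. (W t \<omega> - W s \<omega>) \<bullet> e j"
  shows "integrable M (b j)" "expectation (b j) = 0"
    "integrable M (\<lambda>\<omega>. b j \<omega> * b l \<omega>)"
    "expectation (\<lambda>\<omega>. b j \<omega> * b l \<omega>) = (if j = l then (t - s) * ev j else 0)"
proof -
  have G: "gaussian_rv M ((t - s) *\<^sub>R Q) (\<lambda>\<omega>. W t \<omega> - W s \<omega>)"
    using wiener st by (auto simp: Q_Wiener_def)
  have pos: "((t - s) *\<^sub>R Q) u \<bullet> u \<ge> 0" for u
    using Q_positive st by (cases "u = 0") (auto simp: positive_definite_def scaleR_blinfun.rep_eq less_imp_le)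
  have sa: "self_adjoint ((t - s) *\<^sub>R Q)"
    using Q_self_adjoint by (auto simp: self_adjoint_def scaleR_blinfun.rep_eq)
  show "integrable M (b j)" "expectation (b j) = 0"
    unfolding b_def using gaussian_rv_moments[OF G pos] by auto
  show "integrable M (\<lambda>\<omega>. b j \<omega> * b l \<omega>)"
    unfolding b_def by (rule gaussian_rv_covariance[OF G pos sa])
  show "expectation (\<lambda>\<omega>. b j \<omega> * b l \<omega>) = (if j = l then (t - s) * ev j else 0)"
    unfolding b_def gaussian_rv_covariance[OF G pos sa] using basis
    by (simp add: scaleR_blinfun.rep_eq Q_e orthonormal_basis_def)
qed

text \<open>Here \<open>Z\<close> stands for whatever is known at the start of a step. The linear
  relation is the martingale property that removes mixed terms; the quadratic one says that
  coordinates of an increment along distinct eigenvectors stay orthogonal after weighting by the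
  past.\<close>

lemma increment_product:
  assumes st: "0 \<le> s" "s \<le> t" "t \<le> T"
    and Z: "Z \<in> borel_measurable (F s)" "integrable M Z"
  defines "b \<equiv> \<lambda>j \<omega>. (W t \<omega> - W s \<omega>) \<bullet> e j"
  shows "integrable M (\<lambda>\<omega>. Z \<omega> * b j \<omega>)" "expectation (\<lambda>\<omega>. Z \<omega> * b j \<omega>) = 0"
    "integrable M (\<lambda>\<omega>. Z \<omega> * (b j \<omega> * b l \<omega>))"
    "expectation (\<lambda>\<omega>. Z \<omega> * (b j \<omega> * b l \<omega>)) = (if j = l then (t - s) * ev j * expectation Z else 0)"
proof -
  have ind: "indep_set (sets (F s)) (sets (vimage_algebra (space M) (\<lambda>\<omega>. W t \<omega> - W s \<omega>) borel))"
    using wiener st by (auto simp: Q_Wiener_def)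
  have Y: "(\<lambda>\<omega>. W t \<omega> - W s \<omega>) \<in> borel_measurable M"
    using st by (intro borel_measurable_diff W_measurable) auto
  have s: "space (F s) = space M" "subalgebra M (F s)" using st space_F F_subalgebra by auto
  note m = increment_moments[OF st, folded b_def]
  have h1: "(\<lambda>y. y \<bullet> e j) \<in> borel_measurable borel" and h2: "(\<lambda>y. (y \<bullet> e j) * (y \<bullet> e l)) \<in> borel_measurable borel"
    by measurable
  note p1 = indep_subalgebra_expectation_mult[OF ind s Y h1 Z(1,2), folded b_def, OF m(1)[unfolded b_def]]
  note p2 = indep_subalgebra_expectation_mult[OF ind s Y h2 Z(1,2), OF m(3)[unfolded b_def]]
  show "integrable M (\<lambda>\<omega>. Z \<omega> * b j \<omega>)" "expectation (\<lambda>\<omega>. Z \<omega> * b j \<omega>) = 0"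
    using p1 m(2) by (auto simp: b_def)
  show "integrable M (\<lambda>\<omega>. Z \<omega> * (b j \<omega> * b l \<omega>))"
    "expectation (\<lambda>\<omega>. Z \<omega> * (b j \<omega> * b l \<omega>)) = (if j = l then (t - s) * ev j * expectation Z else 0)"
    using p2 m(4)[of j l] by (auto simp: b_def)
qed

text \<open>Expanding the square leaves only diagonal terms: those linear in the increment are
  centred, and distinct coordinates are orthogonal. The products with the unbounded increments are
  integrable by independence, which needs only integrability of \<open>G j\<close> paired with
  \<open>G l\<close>.\<close>

lemma one_step_isometry:
  fixes Z :: "'w \<Rightarrow> 'h::{real_inner,second_countable_topology}"
  assumes st: "0 \<le> s" "s \<le> t" "t \<le> T"
    and Z: "Z \<in> borel_measurable (F s)" "integrable M (\<lambda>\<omega>. (norm (Z \<omega>))\<^sup>2)"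
    and G: "\<And>j. G j \<in> borel_measurable (F s)" "\<And>j. integrable M (\<lambda>\<omega>. (norm (G j \<omega>))\<^sup>2)"
  defines "b \<equiv> \<lambda>j \<omega>. (W t \<omega> - W s \<omega>) \<bullet> e j"
  shows "integrable M (\<lambda>\<omega>. (norm (Z \<omega> + (\<Sum>j<N. b j \<omega> *\<^sub>R G j \<omega>)))\<^sup>2)"
    "expectation (\<lambda>\<omega>. (norm (Z \<omega> + (\<Sum>j<N. b j \<omega> *\<^sub>R G j \<omega>)))\<^sup>2) =
      expectation (\<lambda>\<omega>. (norm (Z \<omega>))\<^sup>2) + (\<Sum>j<N. (t - s) * ev j * expectation (\<lambda>\<omega>. (norm (G j \<omega>))\<^sup>2))"
proof -
  have b: "(W t \<omega> - W s \<omega>) \<bullet> e j = b j \<omega>" for j \<omega> by (simp add: b_def)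
  have sub: "subalgebra M (F s)" using F_subalgebra st by simp
  have int: "(\<lambda>\<omega>. Y \<omega> \<bullet> Y' \<omega>) \<in> borel_measurable (F s) \<and> integrable M (\<lambda>\<omega>. Y \<omega> \<bullet> Y' \<omega>)"
    if Y: "Y \<in> borel_measurable (F s)" "integrable M (\<lambda>\<omega>. (norm (Y \<omega>))\<^sup>2)"
      "Y' \<in> borel_measurable (F s)" "integrable M (\<lambda>\<omega>. (norm (Y' \<omega>))\<^sup>2)" for Y Y' :: "'w \<Rightarrow> 'h"
  proof
    show *: "(\<lambda>\<omega>. Y \<omega> \<bullet> Y' \<omega>) \<in> borel_measurable (F s)" using Y(1,3) by measurable
    have "\<bar>Y \<omega> \<bullet> Y' \<omega>\<bar> \<le> (norm (Y \<omega>))\<^sup>2 + (norm (Y' \<omega>))\<^sup>2" for \<omega>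
    proof -
      have "\<bar>Y \<omega> \<bullet> Y' \<omega>\<bar> \<le> norm (Y \<omega>) * norm (Y' \<omega>)" by (rule Cauchy_Schwarz_ineq2)
      also have "\<dots> \<le> (norm (Y \<omega>))\<^sup>2 + (norm (Y' \<omega>))\<^sup>2"
        using zero_le_power2[of "norm (Y \<omega>) - norm (Y' \<omega>)"] zero_le_power2[of "norm (Y \<omega>)"]
          zero_le_power2[of "norm (Y' \<omega>)"] mult_nonneg_nonneg[OF norm_ge_zero norm_ge_zero, of "Y \<omega>" "Y' \<omega>"]
        unfolding power2_diff by linarith
      finally show ?thesis .
    qed
    then show "integrable M (\<lambda>\<omega>. Y \<omega> \<bullet> Y' \<omega>)"
      using measurable_from_subalg[OF sub *] Y(2,4)
      by (intro Bochner_Integration.integrable_bound[OF Bochner_Integration.integrable_add[OF Y(2,4)]]) auto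
  qed
  note ZG = int[OF Z G(1) G(2)]
  note GG = int[OF G(1) G(2) G(1) G(2)]
  note p1 = increment_product(1,2)[OF st ZG[THEN conjunct1] ZG[THEN conjunct2], unfolded b]
  note p2 = increment_product(3,4)[OF st GG[THEN conjunct1] GG[THEN conjunct2], unfolded b]
  have eq: "(norm (Z \<omega> + (\<Sum>j<N. b j \<omega> *\<^sub>R G j \<omega>)))\<^sup>2 =
    (norm (Z \<omega>))\<^sup>2 + 2 * (\<Sum>j<N. (Z \<omega> \<bullet> G j \<omega>) * b j \<omega>)
      + (\<Sum>j<N. \<Sum>l<N. (G j \<omega> \<bullet> G l \<omega>) * (b j \<omega> * b l \<omega>))" for \<omega>
  proof -
    let ?S = "\<Sum>j<N. b j \<omega> *\<^sub>R G j \<omega>"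
    have "(norm (Z \<omega> + ?S))\<^sup>2 = (norm (Z \<omega>))\<^sup>2 + 2 * (Z \<omega> \<bullet> ?S) + ?S \<bullet> ?S"
      by (simp add: power2_norm_eq_inner inner_add_left inner_add_right inner_commute)
    moreover have "Z \<omega> \<bullet> ?S = (\<Sum>j<N. (Z \<omega> \<bullet> G j \<omega>) * b j \<omega>)"
      by (simp add: inner_sum_right mult.commute)
    moreover have "?S \<bullet> ?S = (\<Sum>j<N. \<Sum>l<N. (G j \<omega> \<bullet> G l \<omega>) * (b j \<omega> * b l \<omega>))"
      unfolding inner_sum_left unfolding inner_sum_right by (intro sum.cong) (simp_all add: mult_ac inner_commute)
    ultimately show ?thesis by simp
  qed
  show "integrable M (\<lambda>\<omega>. (norm (Z \<omega> + (\<Sum>j<N. b j \<omega> *\<^sub>R G j \<omega>)))\<^sup>2)"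
    unfolding eq
    by (intro Bochner_Integration.integrable_add Z(2) integrable_mult_right Bochner_Integration.integrable_sum p1 p2)
  have "expectation (\<lambda>\<omega>. (norm (Z \<omega> + (\<Sum>j<N. b j \<omega> *\<^sub>R G j \<omega>)))\<^sup>2)
    = expectation (\<lambda>\<omega>. (norm (Z \<omega>))\<^sup>2) + 2 * (\<Sum>j<N. expectation (\<lambda>\<omega>. (Z \<omega> \<bullet> G j \<omega>) * b j \<omega>))
      + (\<Sum>j<N. \<Sum>l<N. expectation (\<lambda>\<omega>. (G j \<omega> \<bullet> G l \<omega>) * (b j \<omega> * b l \<omega>)))"
    unfolding eq using Z(2) p1 p2
    by (simp add: Bochner_Integration.integral_sum del: sum_mult_of_bool_eq)
  also have "\<dots> = expectation (\<lambda>\<omega>. (norm (Z \<omega>))\<^sup>2)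
      + (\<Sum>j<N. (t - s) * ev j * expectation (\<lambda>\<omega>. (norm (G j \<omega>))\<^sup>2))"
    unfolding p1 p2 by (simp add: power2_norm_eq_inner)
  finally show "expectation (\<lambda>\<omega>. (norm (Z \<omega> + (\<Sum>j<N. b j \<omega> *\<^sub>R G j \<omega>)))\<^sup>2) =
      expectation (\<lambda>\<omega>. (norm (Z \<omega>))\<^sup>2) + (\<Sum>j<N. (t - s) * ev j * expectation (\<lambda>\<omega>. (norm (G j \<omega>))\<^sup>2))" .
qed

section \<open>Elementary integrals against finitely many noise coordinates\<close>

lemma elementary_times:
  assumes "elementary F t n \<tau> \<Phi>" "i \<le> j" "j \<le> n"
  shows "\<tau> i \<le> \<tau> j" "0 \<le> \<tau> i" "\<tau> j \<le> t"
proof -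
  have mono: "\<tau> i \<le> \<tau> j" if "i \<le> j" "j \<le> n" for i j
    using that
  proof (induction j rule: dec_induct)
    case (step m)
    then have "\<tau> m \<le> \<tau> (Suc m)" using assms(1) by (simp add: elementary_def)
    with step show ?case by simp
  qed simp
  show "\<tau> i \<le> \<tau> j" using mono assms by simp
  show "0 \<le> \<tau> i" using mono[of 0 i] assms by (simp add: elementary_def)
  show "\<tau> j \<le> t" using mono[of j n] assms by (simp add: elementary_def)
qed

lemma elementary_simple:
  assumes "elementary F t n \<tau> \<Phi>" "k < n" "\<tau> k \<le> s" "s \<le> T" "t \<le> T"
  shows "simple_function (F s) (\<Phi> k)"
proof (rule simple_function_subalgebra)
  show "simple_function (F (\<tau> k)) (\<Phi> k)" using assms by (simp add: elementary_def)
  have "subalgebra (F s) (F (\<tau> k))"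
    using elementary_times(2)[OF assms(1), of k n] assms by (intro F_mono) auto
  then show "sets (F (\<tau> k)) \<subseteq> sets (F s)" "space (F (\<tau> k)) = space (F s)" by (auto simp: subalgebra_def)
qed

text \<open>\<open>J\<close> uses only the first \<open>N\<close> coordinates of the noise, so each
  step adds a finite sum and \<open>one_step_isometry\<close> applies with the sum accumulated so
  far as its \<open>Z\<close>. Measurability at \<open>\<tau> m\<close> belongs to the induction
  because the next step requires an adapted past; integrability of the coefficients is carried along
  for the later passage to nonnegative integrals.\<close>

lemma elementary_integral_projection_isometry:
  fixes \<Phi> :: "nat \<Rightarrow> 'w \<Rightarrow> 'u \<Rightarrow>\<^sub>L 'h::{real_inner,second_countable_topology}"
    and N :: nat
  assumes el: "elementary F t n \<tau> \<Phi>" and t: "t \<le> T" and m: "m \<le> n"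
  defines "J \<equiv> \<lambda>m \<omega>. \<Sum>k<m. \<Sum>j<N. ((W (\<tau> (Suc k)) \<omega> - W (\<tau> k) \<omega>) \<bullet> e j) *\<^sub>R \<Phi> k \<omega> (e j)"
  shows "J m \<in> borel_measurable (F (\<tau> m)) \<and> integrable M (\<lambda>\<omega>. (norm (J m \<omega>))\<^sup>2) \<and>
    expectation (\<lambda>\<omega>. (norm (J m \<omega>))\<^sup>2) =
      (\<Sum>k<m. \<Sum>j<N. (\<tau> (Suc k) - \<tau> k) * expectation (\<lambda>\<omega>. (norm (\<Phi> k \<omega> (g j)))\<^sup>2)) \<and>
    (\<forall>k<m. \<forall>j. integrable M (\<lambda>\<omega>. (norm (\<Phi> k \<omega> (g j)))\<^sup>2))"
  using m
proof (induction m)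
  case 0
  show ?case by (simp add: J_def)
next
  case (Suc m)
  then have IH: "J m \<in> borel_measurable (F (\<tau> m))" "integrable M (\<lambda>\<omega>. (norm (J m \<omega>))\<^sup>2)"
    "expectation (\<lambda>\<omega>. (norm (J m \<omega>))\<^sup>2) =
      (\<Sum>k<m. \<Sum>j<N. (\<tau> (Suc k) - \<tau> k) * expectation (\<lambda>\<omega>. (norm (\<Phi> k \<omega> (g j)))\<^sup>2))"
    "\<forall>k<m. \<forall>j. integrable M (\<lambda>\<omega>. (norm (\<Phi> k \<omega> (g j)))\<^sup>2)"
    by auto
  have st: "0 \<le> \<tau> m" "\<tau> m \<le> \<tau> (Suc m)" "\<tau> (Suc m) \<le> T"
    using elementary_times[OF el, of m "Suc m"] Suc.prems t by auto
  have sf: "simple_function (F (\<tau> m)) (\<Phi> m)" using el Suc.prems by (simp add: elementary_def)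
  define b where "b j \<omega> = (W (\<tau> (Suc m)) \<omega> - W (\<tau> m) \<omega>) \<bullet> e j" for j \<omega>
  have sfM: "simple_function M (\<Phi> m)"
    using F_subalgebra[of "\<tau> m"] st by (intro simple_function_subalgebra[OF sf]) (auto simp: subalgebra_def)
  have Gm: "(\<lambda>\<omega>. \<Phi> m \<omega> u) \<in> borel_measurable (F (\<tau> m))" for u
    using borel_measurable_simple_function[OF simple_function_compose[OF sf, of "\<lambda>f. blinfun_apply f u"]]
    by (simp add: comp_def)
  \<comment> \<open>A simple function takes finitely many values, hence is bounded.\<close>
  have Gi: "integrable M (\<lambda>\<omega>. (norm (\<Phi> m \<omega> u))\<^sup>2)" for u
  proof -
    have s: "simple_function M (\<lambda>\<omega>. (norm (\<Phi> m \<omega> u))\<^sup>2)"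
      using simple_function_compose[OF sfM, of "\<lambda>f. (norm (blinfun_apply f u))\<^sup>2"] by (simp add: comp_def)
    let ?I = "(\<lambda>\<omega>. (norm (\<Phi> m \<omega> u))\<^sup>2) ` space M"
    have "finite ?I" using s by (rule simple_functionD)
    then have "x \<le> Max ?I" if "x \<in> ?I" for x using that by simp
    then show ?thesis
      by (intro integrable_const_bound[where B="Max ?I"] borel_measurable_simple_function[OF s] AE_I2) auto
  qed
  \<comment> \<open>The variance \<open>ev j\<close> of the noise along \<open>e j\<close> is
    absorbed into the direction. This is how the basis \<open>g\<close>, and with it the
    Hilbert-Schmidt norm on the Cameron-Martin space \<open>U0 Q\<close>, enters.\<close>
  have g_e: "(norm (\<Phi> k \<omega> (g j)))\<^sup>2 = ev j * (norm (\<Phi> k \<omega> (e j)))\<^sup>2" for k j \<omega>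
    using ev_pos[of j] by (simp add: g_eq blinfun.scaleR_right power_mult_distrib)
  have JS: "J (Suc m) \<omega> = J m \<omega> + (\<Sum>j<N. b j \<omega> *\<^sub>R \<Phi> m \<omega> (e j))" for \<omega>
    by (simp add: J_def b_def)
  have os: "integrable M (\<lambda>\<omega>. (norm (J (Suc m) \<omega>))\<^sup>2)"
    "expectation (\<lambda>\<omega>. (norm (J (Suc m) \<omega>))\<^sup>2) = expectation (\<lambda>\<omega>. (norm (J m \<omega>))\<^sup>2) +
      (\<Sum>j<N. (\<tau> (Suc m) - \<tau> m) * ev j * expectation (\<lambda>\<omega>. (norm (\<Phi> m \<omega> (e j)))\<^sup>2))"
    using one_step_isometry[OF st IH(1,2) Gm Gi, of e N] unfolding JS b_def by auto
  have "J (Suc m) \<in> borel_measurable (F (\<tau> (Suc m)))"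
  proof -
    have sub: "subalgebra (F (\<tau> (Suc m))) (F (\<tau> m))" using st by (intro F_mono) auto
    have [measurable]: "W (\<tau> (Suc m)) \<in> borel_measurable (F (\<tau> (Suc m)))"
      "W (\<tau> m) \<in> borel_measurable (F (\<tau> (Suc m)))" "J m \<in> borel_measurable (F (\<tau> (Suc m)))"
      "(\<lambda>\<omega>. \<Phi> m \<omega> u) \<in> borel_measurable (F (\<tau> (Suc m)))" for u
      using st W_measurable_F measurable_from_subalg[OF sub W_measurable_F]
        measurable_from_subalg[OF sub IH(1)] measurable_from_subalg[OF sub Gm] by auto
    show ?thesis unfolding JS b_def by measurable
  qed
  moreover have "expectation (\<lambda>\<omega>. (norm (J (Suc m) \<omega>))\<^sup>2) =
      (\<Sum>k<Suc m. \<Sum>j<N. (\<tau> (Suc k) - \<tau> k) * expectation (\<lambda>\<omega>. (norm (\<Phi> k \<omega> (g j)))\<^sup>2))"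
    unfolding os(2) IH(3) by (simp add: g_e mult.assoc)
  moreover have "\<forall>k<Suc m. \<forall>j. integrable M (\<lambda>\<omega>. (norm (\<Phi> k \<omega> (g j)))\<^sup>2)"
    using IH(4) Gi by (auto simp: less_Suc_eq)
  ultimately show ?case using os(1) by blast
qed

text \<open>The time integral of the squared Hilbert-Schmidt norm of the step process. As a finite
  sum over steps it has partial sums up to \<open>Suc k\<close> that involve only coefficients known
  at \<open>\<tau> k\<close>; with values in \<open>ennreal\<close> the series over \<open>j\<close>
  can be formed before any convergence is known.\<close>

definition quadratic_variation ::
  "nat \<Rightarrow> (nat \<Rightarrow> real) \<Rightarrow> (nat \<Rightarrow> 'w \<Rightarrow> 'u \<Rightarrow>\<^sub>L 'h::real_normed_vector) \<Rightarrow> 'w \<Rightarrow> ennreal" where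
  "quadratic_variation n \<tau> \<Phi> \<omega> =
     (\<Sum>k<n. ennreal (\<tau> (Suc k) - \<tau> k) * (\<Sum>j. ennreal ((norm (\<Phi> k \<omega> (g j)))\<^sup>2)))"

lemma elementary_apply_measurable:
  fixes \<Phi> :: "nat \<Rightarrow> 'w \<Rightarrow> 'u \<Rightarrow>\<^sub>L 'h::{real_normed_vector,second_countable_topology}"
  assumes "elementary F t n \<tau> \<Phi>" "k < n" "\<tau> k \<le> s" "s \<le> T" "t \<le> T"
  shows "(\<lambda>\<omega>. \<Phi> k \<omega> u) \<in> borel_measurable (F s)"
  using borel_measurable_simple_function[OF simple_function_compose[OF elementary_simple[OF assms], of "\<lambda>f. blinfun_apply f u"]]
  by (simp add: comp_def)

lemma elementary_apply_measurable_M: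
  fixes \<Phi> :: "nat \<Rightarrow> 'w \<Rightarrow> 'u \<Rightarrow>\<^sub>L 'h::{real_normed_vector,second_countable_topology}"
  assumes "elementary F t n \<tau> \<Phi>" "k < n" "t \<le> T"
  shows "(\<lambda>\<omega>. \<Phi> k \<omega> u) \<in> borel_measurable M"
  using elementary_times(2,3)[OF assms(1), of k k] assms
  by (intro measurable_from_subalg[OF F_subalgebra elementary_apply_measurable[OF assms(1,2) order_refl]]) auto

lemma elem_integral_projection_tendsto:
  fixes \<Phi> :: "nat \<Rightarrow> 'w \<Rightarrow> 'u \<Rightarrow>\<^sub>L 'h::real_normed_vector"
  shows "(\<lambda>N. \<Sum>k<n. \<Sum>j<N. ((W (\<tau> (Suc k)) \<omega> - W (\<tau> k) \<omega>) \<bullet> e j) *\<^sub>R \<Phi> k \<omega> (e j))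
    \<longlonglongrightarrow> elem_integral W n \<tau> \<Phi> \<omega>"
proof -
  have "(\<lambda>N. \<Sum>k<n. \<Phi> k \<omega> (\<Sum>j<N. ((W (\<tau> (Suc k)) \<omega> - W (\<tau> k) \<omega>) \<bullet> e j) *\<^sub>R e j))
    \<longlonglongrightarrow> elem_integral W n \<tau> \<Phi> \<omega>"
    unfolding elem_integral_def
    by (intro tendsto_sum blinfun.tendsto[OF tendsto_const] orthonormal_basis_expansion[OF basis])
  then show ?thesis by (simp add: blinfun.sum_right blinfun.scaleR_right)
qed

lemma elementary_integral_measurable:
  fixes \<Phi> :: "nat \<Rightarrow> 'w \<Rightarrow> 'u \<Rightarrow>\<^sub>L 'h::{real_inner,second_countable_topology}"
  assumes el: "elementary F t n \<tau> \<Phi>" and t: "t \<le> T"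
  shows "elem_integral W n \<tau> \<Phi> \<in> borel_measurable M"
proof (rule borel_measurable_LIMSEQ_metric)
  let ?J = "\<lambda>N \<omega>. \<Sum>k<n. \<Sum>j<N. ((W (\<tau> (Suc k)) \<omega> - W (\<tau> k) \<omega>) \<bullet> e j) *\<^sub>R \<Phi> k \<omega> (e j)"
  show "?J N \<in> borel_measurable M" for N
    using elementary_integral_projection_isometry[OF el t order_refl, of N] F_subalgebra[of "\<tau> n"]
      elementary_times[OF el, of n n] t measurable_from_subalg[of M "F (\<tau> n)"] by auto
qed (rule elem_integral_projection_tendsto)

text \<open>For each finite set of noise coordinates there is an exact isometry, bounded by the full
  series. Fatou's lemma lets the number of coordinates tend to infinity; it keeps the inequality,
  which is all that is used later.\<close>

lemma elementary_integral_L2_bound: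
  fixes \<Phi> :: "nat \<Rightarrow> 'w \<Rightarrow> 'u \<Rightarrow>\<^sub>L 'h::{real_inner,second_countable_topology}"
  assumes el: "elementary F t n \<tau> \<Phi>" and t: "t \<le> T"
  shows "(\<integral>\<^sup>+\<omega>. ennreal ((norm (elem_integral W n \<tau> \<Phi> \<omega>))\<^sup>2) \<partial>M) \<le> (\<integral>\<^sup>+\<omega>. quadratic_variation n \<tau> \<Phi> \<omega> \<partial>M)"
proof -
  let ?J = "\<lambda>N \<omega>. \<Sum>k<n. \<Sum>j<N. ((W (\<tau> (Suc k)) \<omega> - W (\<tau> k) \<omega>) \<bullet> e j) *\<^sub>R \<Phi> k \<omega> (e j)"
  have J: "?J N \<in> borel_measurable M" "integrable M (\<lambda>\<omega>. (norm (?J N \<omega>))\<^sup>2)"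
    "expectation (\<lambda>\<omega>. (norm (?J N \<omega>))\<^sup>2) =
      (\<Sum>k<n. \<Sum>j<N. (\<tau> (Suc k) - \<tau> k) * expectation (\<lambda>\<omega>. (norm (\<Phi> k \<omega> (g j)))\<^sup>2))"
    "\<And>k j. k < n \<Longrightarrow> integrable M (\<lambda>\<omega>. (norm (\<Phi> k \<omega> (g j)))\<^sup>2)" for N
    using elementary_integral_projection_isometry[OF el t order_refl, of N] F_subalgebra[of "\<tau> n"]
      elementary_times[OF el, of n n] t measurable_from_subalg[of M "F (\<tau> n)"] by auto
  have d: "0 \<le> \<tau> (Suc k) - \<tau> k" if "k < n" for k
    using elementary_times(1)[OF el, of k "Suc k"] that by simp
  have [measurable]: "(\<lambda>\<omega>. \<Phi> k \<omega> u) \<in> borel_measurable M" if "k < n" for k u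
    using elementary_apply_measurable_M[OF el that t] .
  have le: "(\<integral>\<^sup>+\<omega>. ennreal ((norm (?J N \<omega>))\<^sup>2) \<partial>M) \<le> (\<integral>\<^sup>+\<omega>. quadratic_variation n \<tau> \<Phi> \<omega> \<partial>M)" for N
  proof -
    have "(\<integral>\<^sup>+\<omega>. ennreal ((norm (?J N \<omega>))\<^sup>2) \<partial>M) = ennreal (expectation (\<lambda>\<omega>. (norm (?J N \<omega>))\<^sup>2))"
      using J(2) by (intro nn_integral_eq_integral) auto
    also have "\<dots> = (\<Sum>k<n. \<Sum>j<N. ennreal (\<tau> (Suc k) - \<tau> k) * (\<integral>\<^sup>+\<omega>. ennreal ((norm (\<Phi> k \<omega> (g j)))\<^sup>2) \<partial>M))"
      unfolding J(3) using d J(4)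
      by (subst sum_ennreal[symmetric], force intro!: sum_nonneg mult_nonneg_nonneg)
        (auto intro!: sum.cong simp: sum_ennreal[symmetric] ennreal_mult nn_integral_eq_integral)
    also have "\<dots> = (\<integral>\<^sup>+\<omega>. (\<Sum>k<n. ennreal (\<tau> (Suc k) - \<tau> k) * (\<Sum>j<N. ennreal ((norm (\<Phi> k \<omega> (g j)))\<^sup>2))) \<partial>M)"
      unfolding sum_distrib_left
      by (subst nn_integral_sum, measurable; intro sum.cong refl, subst nn_integral_sum, measurable)
        (auto intro!: sum.cong simp: nn_integral_cmult)
    also have "\<dots> \<le> (\<integral>\<^sup>+\<omega>. quadratic_variation n \<tau> \<Phi> \<omega> \<partial>M)"
      unfolding quadratic_variation_def
      by (intro nn_integral_mono sum_mono mult_left_mono sum_le_suminf) auto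
    finally show ?thesis .
  qed
  have "(\<integral>\<^sup>+\<omega>. ennreal ((norm (elem_integral W n \<tau> \<Phi> \<omega>))\<^sup>2) \<partial>M)
    = (\<integral>\<^sup>+\<omega>. liminf (\<lambda>N. ennreal ((norm (?J N \<omega>))\<^sup>2)) \<partial>M)"
  proof (rule nn_integral_cong)
    fix \<omega>
    have "(\<lambda>N. ennreal ((norm (?J N \<omega>))\<^sup>2)) \<longlonglongrightarrow> ennreal ((norm (elem_integral W n \<tau> \<Phi> \<omega>))\<^sup>2)"
      by (intro tendsto_ennrealI tendsto_power tendsto_norm elem_integral_projection_tendsto)
    then show "ennreal ((norm (elem_integral W n \<tau> \<Phi> \<omega>))\<^sup>2) = liminf (\<lambda>N. ennreal ((norm (?J N \<omega>))\<^sup>2))"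
      by (intro lim_imp_Liminf[symmetric]) auto
  qed
  also have "\<dots> \<le> liminf (\<lambda>N. \<integral>\<^sup>+\<omega>. ennreal ((norm (?J N \<omega>))\<^sup>2) \<partial>M)"
  proof (rule nn_integral_liminf)
    fix N
    have [measurable]: "?J N \<in> borel_measurable M" by (rule J)
    show "(\<lambda>\<omega>. ennreal ((norm (?J N \<omega>))\<^sup>2)) \<in> borel_measurable M" by measurable
  qed
  \<comment> \<open>A bound valid for every \<open>N\<close> passes directly to the upper limit,
    hence to the lower one.\<close>
  also have "\<dots> \<le> limsup (\<lambda>N. \<integral>\<^sup>+\<omega>. ennreal ((norm (?J N \<omega>))\<^sup>2) \<partial>M)"
    by (rule Liminf_le_Limsup) simp
  also have "\<dots> \<le> (\<integral>\<^sup>+\<omega>. quadratic_variation n \<tau> \<Phi> \<omega> \<partial>M)"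
    by (rule Limsup_bounded) (simp add: le)
  finally show ?thesis .
qed

lemma quadratic_variation_le:
  fixes \<Phi> :: "nat \<Rightarrow> 'w \<Rightarrow> 'u \<Rightarrow>\<^sub>L 'h::{real_normed_vector,second_countable_topology}"
  assumes el: "elementary F t n \<tau> \<Phi>"
  shows "quadratic_variation n \<tau> \<Phi> \<omega> \<le>
    (\<integral>\<^sup>+s\<in>{0..t}. (\<Sum>j. ennreal ((norm (elem_process n \<tau> \<Phi> s \<omega> (g j)))\<^sup>2)) \<partial>lborel)"
proof -
  define c where "c k = (\<Sum>j. ennreal ((norm (\<Phi> k \<omega> (g j)))\<^sup>2))" for k
  have "quadratic_variation n \<tau> \<Phi> \<omega> = (\<Sum>k<n. \<integral>\<^sup>+s. c k * indicator {\<tau> k<..\<tau> (Suc k)} s \<partial>lborel)"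
    unfolding quadratic_variation_def c_def[symmetric]
    using elementary_times(1)[OF el, of k "Suc k" for k]
    by (intro sum.cong) (auto simp: nn_integral_cmult_indicator mult.commute)
  also have "\<dots> = (\<integral>\<^sup>+s. (\<Sum>k<n. c k * indicator {\<tau> k<..\<tau> (Suc k)} s) \<partial>lborel)"
    by (rule nn_integral_sum[symmetric]) measurable
  also have "\<dots> \<le> (\<integral>\<^sup>+s\<in>{0..t}. (\<Sum>j. ennreal ((norm (elem_process n \<tau> \<Phi> s \<omega> (g j)))\<^sup>2)) \<partial>lborel)"
  proof (rule nn_integral_mono)
    fix s :: real
    show "(\<Sum>k<n. c k * indicator {\<tau> k<..\<tau> (Suc k)} s) \<le>
      (\<Sum>j. ennreal ((norm (elem_process n \<tau> \<Phi> s \<omega> (g j)))\<^sup>2)) * indicator {0..t} s"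
    \<comment> \<open>The half-open intervals are disjoint, so at each time at most one coefficient
      survives and the square of the sum is a single square.\<close>
    proof (cases "\<exists>k<n. s \<in> {\<tau> k<..\<tau> (Suc k)}")
      case True
      then obtain k where k: "k < n" "s \<in> {\<tau> k<..\<tau> (Suc k)}" by blast
      have other: "s \<notin> {\<tau> i<..\<tau> (Suc i)}" if "i < n" "i \<noteq> k" for i
        using elementary_times(1)[OF el, of "Suc i" k] elementary_times(1)[OF el, of "Suc k" i] k that
        by (cases "i < k") (auto simp: Suc_le_eq)
      have st: "s \<in> {0..t}"
        using k elementary_times[OF el, of k "Suc k"] by auto
      have "elem_process n \<tau> \<Phi> s \<omega> u = (\<Sum>i<n. if i = k then \<Phi> k \<omega> u else 0)" for u
        unfolding elem_process_def using k other by (intro sum.cong) auto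
      then have ep: "elem_process n \<tau> \<Phi> s \<omega> u = \<Phi> k \<omega> u" for u using k by simp
      have "(\<Sum>i<n. c i * indicator {\<tau> i<..\<tau> (Suc i)} s) = (\<Sum>i<n. if i = k then c k else 0)"
        using k other by (intro sum.cong) auto
      then have "(\<Sum>i<n. c i * indicator {\<tau> i<..\<tau> (Suc i)} s) = c k" using k by simp
      then show ?thesis using st by (simp add: ep c_def)
    next
      case False
      then show ?thesis by simp
    qed
  qed
  finally show ?thesis .
qed

text \<open>A discrete stopping rule. The test uses \<open>Suc k\<close>, so the step about to be
  taken is already charged to the budget and the total never overshoots \<open>R\<close>. Since
  quadratic variation is monotone, one failed test makes all later ones fail.\<close>

definition truncate ::
  "ennreal \<Rightarrow> (nat \<Rightarrow> real) \<Rightarrow> (nat \<Rightarrow> 'w \<Rightarrow> 'u \<Rightarrow>\<^sub>L 'h::real_normed_vector) \<Rightarrow> nat \<Rightarrow> 'w \<Rightarrow> 'u \<Rightarrow>\<^sub>L 'h" where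
  "truncate R \<tau> \<Phi> k \<omega> = (if quadratic_variation (Suc k) \<tau> \<Phi> \<omega> \<le> R then \<Phi> k \<omega> else 0)"

lemma quadratic_variation_mono:
  assumes "m \<le> n"
  shows "quadratic_variation m \<tau> \<Phi> \<omega> \<le> quadratic_variation n \<tau> \<Phi> \<omega>"
  unfolding quadratic_variation_def
proof (rule sum_mono2)
  show "{..<m} \<subseteq> {..<n}" using assms by auto
qed (rule finite_lessThan, rule zero_le)

text \<open>In the induction either the full sum, including the new step, is still within budget and
  dominates the truncated one, or the new coefficient is zero and nothing is added.\<close>

lemma quadratic_variation_truncate:
  "quadratic_variation n \<tau> (truncate R \<tau> \<Phi>) \<omega> \<le> min R (quadratic_variation n \<tau> \<Phi> \<omega>)"
proof -
  have le: "quadratic_variation n \<tau> (truncate R \<tau> \<Phi>) \<omega> \<le> quadratic_variation n \<tau> \<Phi> \<omega>" for n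
    unfolding quadratic_variation_def
    by (intro sum_mono mult_left_mono suminf_le allI) (simp_all add: truncate_def)
  have "quadratic_variation n \<tau> (truncate R \<tau> \<Phi>) \<omega> \<le> R"
  proof (induction n)
    case 0
    show ?case by (simp add: quadratic_variation_def)
  next
    case (Suc n)
    show ?case
    proof (cases "quadratic_variation (Suc n) \<tau> \<Phi> \<omega> \<le> R")
      case True
      with le[of "Suc n"] show ?thesis by (rule order_trans)
    next
      case False
      then have "truncate R \<tau> \<Phi> n \<omega> = 0" by (simp add: truncate_def)
      then have "quadratic_variation (Suc n) \<tau> (truncate R \<tau> \<Phi>) \<omega> = quadratic_variation n \<tau> (truncate R \<tau> \<Phi>) \<omega>"
        unfolding quadratic_variation_def sum.lessThan_Suc by simp
      with Suc show ?thesis by simp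
    qed
  qed
  with le show ?thesis by (intro min.boundedI)
qed

text \<open>If the total stays within \<open>R\<close>, so does every partial sum, and no step was
  cut. This pathwise identity plays the part of localization by a stopping time.\<close>

lemma elem_integral_truncate:
  assumes "quadratic_variation n \<tau> \<Phi> \<omega> \<le> R"
  shows "elem_integral W n \<tau> (truncate R \<tau> \<Phi>) \<omega> = elem_integral W n \<tau> \<Phi> \<omega>"
  unfolding elem_integral_def
proof (rule sum.cong)
  fix k assume "k \<in> {..<n}"
  then have "quadratic_variation (Suc k) \<tau> \<Phi> \<omega> \<le> R"
    using quadratic_variation_mono[of "Suc k" n \<tau> \<Phi> \<omega>] assms by (auto intro: order_trans)
  then show "truncate R \<tau> \<Phi> k \<omega> (W (\<tau> (Suc k)) \<omega> - W (\<tau> k) \<omega>) = \<Phi> k \<omega> (W (\<tau> (Suc k)) \<omega> - W (\<tau> k) \<omega>)"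
    by (simp add: truncate_def)
qed simp

text \<open>Adaptedness survives because the test at step \<open>k\<close> looks only at
  \<open>\<Phi> 0\<close> to \<open>\<Phi> k\<close>, all of them measurable at time
  \<open>\<tau> k\<close>.\<close>

lemma elementary_truncate:
  fixes \<Phi> :: "nat \<Rightarrow> 'w \<Rightarrow> 'u \<Rightarrow>\<^sub>L 'h::{real_normed_vector,second_countable_topology}"
  assumes el: "elementary F t n \<tau> \<Phi>" and t: "t \<le> T"
  shows "elementary F t n \<tau> (truncate R \<tau> \<Phi>)"
proof -
  have "simple_function (F (\<tau> k)) (truncate R \<tau> \<Phi> k)" if k: "k < n" for k
  proof -
    have kt: "\<tau> k \<le> T" using elementary_times(3)[OF el, of k k] k t by simp
    have [measurable]: "(\<lambda>\<omega>. \<Phi> i \<omega> u) \<in> borel_measurable (F (\<tau> k))" if "i < Suc k" for i u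
      using elementary_apply_measurable[OF el _ _ kt t, of i] elementary_times(1)[OF el, of i k] k that by simp
    have [measurable]: "quadratic_variation (Suc k) \<tau> \<Phi> \<in> borel_measurable (F (\<tau> k))"
      unfolding quadratic_variation_def[abs_def] by measurable
    show ?thesis
      unfolding truncate_def[abs_def]
      using el k by (intro simple_function_If) (auto simp: elementary_def)
  qed
  then show ?thesis using el by (simp add: elementary_def)
qed

text \<open>The generators of the predictable sigma-algebra are measurable rectangles, so it is
  contained in the product sigma-algebra restricted to the time interval. Extension by zero gives a
  function on the whole product, where time integrals of sections are measurable.\<close>

lemma predictable_measurable:
  fixes f :: "real \<Rightarrow> 'w \<Rightarrow> 'b::real_normed_vector"
  assumes t: "0 \<le> t" "t \<le> T" and f: "(\<lambda>(s, \<omega>). f s \<omega>) \<in> borel_measurable (predictable_sigma M F t)"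
  shows "(\<lambda>(s, \<omega>). indicator {0..t} s *\<^sub>R f s \<omega>) \<in> borel_measurable (lborel \<Otimes>\<^sub>M M)"
proof -
  let ?\<Omega> = "{0..t} \<times> space M"
  let ?R = "restrict_space (lborel \<Otimes>\<^sub>M M) ?\<Omega>"
  have \<Omega>: "?\<Omega> \<inter> space (lborel \<Otimes>\<^sub>M M) \<in> sets (lborel \<Otimes>\<^sub>M M)" by measurable
  have F_sets: "A \<in> sets M" if "A \<in> sets (F s)" "0 \<le> s" "s \<le> t" for s A
    using F_subalgebra[of s] that t by (auto simp: subalgebra_def)
  have gen: "{{0} \<times> A |A. A \<in> sets (F 0)} \<union>
        {{a<..b} \<times> A |a b A. 0 \<le> a \<and> a \<le> b \<and> b \<le> t \<and> A \<in> sets (F a)} \<subseteq> sets ?R" (is "?G \<subseteq> _")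
  proof
    fix B assume "B \<in> ?G"
    then have "B \<in> sets (lborel \<Otimes>\<^sub>M M) \<and> B \<subseteq> ?\<Omega>"
    proof
      assume "B \<in> {{0} \<times> A |A. A \<in> sets (F 0)}"
      then obtain A where "B = {0} \<times> A" "A \<in> sets (F 0)" by blast
      with F_sets[of A 0] t sets.sets_into_space[of A M] show ?thesis by auto
    next
      assume "B \<in> {{a<..b} \<times> A |a b A. 0 \<le> a \<and> a \<le> b \<and> b \<le> t \<and> A \<in> sets (F a)}"
      then obtain a b A where "B = {a<..b} \<times> A" "0 \<le> a" "a \<le> b" "b \<le> t" "A \<in> sets (F a)" by blast
      with F_sets[of A a] t sets.sets_into_space[of A M] show ?thesis by auto
    qed
    then show "B \<in> sets ?R" using \<Omega> by (auto simp: sets_restrict_space_iff)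
  qed
  have sp: "space ?R = ?\<Omega>" by (auto simp: space_restrict_space space_pair_measure)
  have "?G \<subseteq> Pow ?\<Omega>" using gen sets.space_closed[of ?R] unfolding sp by (rule order_trans)
  then have sub: "sets (predictable_sigma M F t) \<subseteq> sets ?R" "space (predictable_sigma M F t) = space ?R"
    using sets.sigma_sets_subset[OF gen] unfolding predictable_sigma_def sp
    by (simp_all only: sets_measure_of space_measure_of)
  have "subalgebra ?R (predictable_sigma M F t)" using sub by (simp add: subalgebra_def)
  from measurable_from_subalg[OF this f]
  have "(\<lambda>x. indicator ?\<Omega> x *\<^sub>R (case x of (s, \<omega>) \<Rightarrow> f s \<omega>)) \<in> borel_measurable (lborel \<Otimes>\<^sub>M M)"
    using borel_measurable_restrict_space_iff[OF \<Omega>] by blast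
  then show ?thesis
    by (rule measurable_cong[THEN iffD1, rotated]) (auto simp: space_pair_measure indicator_def)
qed

end

section \<open>The truncated isometry\<close>

text \<open>Capping at 1 turns convergence in probability into convergence in L1, for which almost
  surely convergent subsequences exist.\<close>

lemma (in prob_space) tendsto_probability_AE_subseq:
  fixes Z :: "nat \<Rightarrow> 'a \<Rightarrow> real"
  assumes [measurable]: "\<And>m. Z m \<in> borel_measurable M"
    and nonneg: "\<And>m \<omega>. 0 \<le> Z m \<omega>"
    and lim: "\<And>\<epsilon>. \<epsilon> > 0 \<Longrightarrow> (\<lambda>m. prob {\<omega>\<in>space M. Z m \<omega> > \<epsilon>}) \<longlonglongrightarrow> 0"
  shows "\<exists>r::nat\<Rightarrow>nat. strict_mono r \<and> (AE \<omega> in M. (\<lambda>m. Z (r m) \<omega>) \<longlonglongrightarrow> 0)"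
proof -
  have int: "integrable M (\<lambda>\<omega>. min 1 (Z m \<omega>))" for m
    by (rule integrable_const_bound[where B=1]) (auto simp: nonneg)
  have "(\<lambda>m. expectation (\<lambda>\<omega>. min 1 (Z m \<omega>))) \<longlonglongrightarrow> 0"
  proof (rule LIMSEQ_I)
    fix d :: real assume d: "d > 0"
    from LIMSEQ_D[OF lim[of "d/2"], of "d/2"] d
    obtain m0 where m0: "\<And>m. m \<ge> m0 \<Longrightarrow> prob {\<omega>\<in>space M. Z m \<omega> > d/2} < d/2" by auto
    show "\<exists>no. \<forall>m\<ge>no. norm (expectation (\<lambda>\<omega>. min 1 (Z m \<omega>)) - 0) < d"
    proof (intro exI allI impI)
      fix m assume m: "m0 \<le> m"
      have ie: "integrable M (indicator {\<omega>\<in>space M. Z m \<omega> > d/2} :: 'a \<Rightarrow> real)"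
        by (rule integrable_real_indicator) (auto simp: emeasure_eq_measure)
      \<comment> \<open>Split at the level \<open>d/2\<close>: below it the capped variable is at
        most \<open>d/2\<close>, above it at most 1 on an event of probability less than
        \<open>d/2\<close>.\<close>
      have "expectation (\<lambda>\<omega>. min 1 (Z m \<omega>)) \<le> expectation (\<lambda>\<omega>. d/2 + indicator {\<omega>\<in>space M. Z m \<omega> > d/2} \<omega>)"
        using d by (intro integral_mono int Bochner_Integration.integrable_add integrable_const ie)
          (auto simp: indicator_def)
      also have "\<dots> = d/2 + prob {\<omega>\<in>space M. Z m \<omega> > d/2}" using ie by (simp add: prob_space)
      also have "\<dots> < d" using m0[OF m] by simp
      finally show "norm (expectation (\<lambda>\<omega>. min 1 (Z m \<omega>)) - 0) < d"
        using Bochner_Integration.integral_nonneg[of M "\<lambda>\<omega>. min 1 (Z m \<omega>)"] nonneg by simp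
    qed
  qed
  then have "(\<lambda>m. \<integral>\<omega>. norm (min 1 (Z m \<omega>)) \<partial>M) \<longlonglongrightarrow> 0" using nonneg by simp
  from tendsto_L1_AE_subseq[OF int this] obtain r :: "nat \<Rightarrow> nat" where
    r: "strict_mono r" "AE \<omega> in M. (\<lambda>m. min 1 (Z (r m) \<omega>)) \<longlonglongrightarrow> 0" by auto
  have "AE \<omega> in M. (\<lambda>m. Z (r m) \<omega>) \<longlonglongrightarrow> 0"
    using r(2)
  proof eventually_elim
    case (elim \<omega>)
    \<comment> \<open>The limit 0 lies below the cap, so the cap is eventually inactive.\<close>
    then have "eventually (\<lambda>m. min 1 (Z (r m) \<omega>) < 1) sequentially"
      by (rule order_tendstoD) simp
    then have "eventually (\<lambda>m. min 1 (Z (r m) \<omega>) = Z (r m) \<omega>) sequentially"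
      by eventually_elim (auto simp: min_def split: if_splits)
    with elim show ?case by (rule Lim_transform_eventually)
  qed
  with r(1) show ?thesis by blast
qed

lemma norm_add_power2_le:
  fixes a b :: "'b::real_normed_vector"
  shows "(norm (a + b))\<^sup>2 \<le> 2 * (norm a)\<^sup>2 + 2 * (norm b)\<^sup>2"
proof -
  have "(norm (a + b))\<^sup>2 \<le> (norm a + norm b)\<^sup>2" by (simp add: norm_triangle_ineq power_mono)
  also have "\<dots> \<le> 2 * (norm a)\<^sup>2 + 2 * (norm b)\<^sup>2"
    using zero_le_power2[of "norm a - norm b"] by (simp add: power2_sum power2_diff)
  finally show ?thesis .
qed

lemma ennreal_norm_power2_le:
  fixes a b :: "'b::real_normed_vector"
  shows "ennreal ((norm a)\<^sup>2) \<le> 2 * ennreal ((norm b)\<^sup>2) + 2 * ennreal ((norm (a - b))\<^sup>2)"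
proof -
  have "ennreal ((norm a)\<^sup>2) \<le> ennreal (2 * (norm b)\<^sup>2 + 2 * (norm (a - b))\<^sup>2)"
    using norm_add_power2_le[of b "a - b"] by (intro ennreal_leI) simp
  then show ?thesis by (simp add: ennreal_mult)
qed

lemma nn_integral_section_measurable:
  assumes "h \<in> borel_measurable (lborel \<Otimes>\<^sub>M M)"
  shows "(\<lambda>\<omega>. \<integral>\<^sup>+s. h (s, \<omega>) \<partial>lborel) \<in> borel_measurable M"
proof (rule lborel.borel_measurable_nn_integral)
  show "(\<lambda>(\<omega>, s). h (s, \<omega>)) \<in> borel_measurable (M \<Otimes>\<^sub>M lborel)"
    by (rule measurable_pair_swap[OF assms])
qed

section \<open>From elementary to general integrands\<close>

context wiener_integral
begin

text \<open>A localized substitute for the isometry when the integrand has no moments. Along a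
  subsequence, almost surely on the event \<open>V \<omega> \<le> ennreal R\<close>, the
  approximants eventually have quadratic variation at most 3R, so cutting them there does not change
  the limit \<open>I\<close>, while the cut keeps their second moments bounded. Fatou's lemma treats
  the left side and dominated convergence the right.\<close>

lemma stochastic_integral_truncated_L2_bound:
  fixes \<Psi> :: "real \<Rightarrow> 'w \<Rightarrow> 'u \<Rightarrow> 'h::{real_inner,second_countable_topology}"
  assumes t: "0 \<le> t" "t \<le> T" and SI: "has_stoch_integral M F Q g W t \<Psi> I" and R: "R > 0"
  defines "V \<equiv> \<lambda>\<omega>. \<integral>\<^sup>+s\<in>{0..t}. (\<Sum>j. ennreal ((norm (\<Psi> s \<omega> (g j)))\<^sup>2)) \<partial>lborel"
  shows "V \<in> borel_measurable M"
    and "(\<integral>\<^sup>+\<omega>. ennreal ((norm (I \<omega>))\<^sup>2) * indicator {\<omega>. V \<omega> \<le> ennreal R} \<omega> \<partial>M)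
      \<le> 3 * (\<integral>\<^sup>+\<omega>. min (ennreal R) (V \<omega>) \<partial>M)"
proof -
  have pred: "\<And>j. (\<lambda>(s, \<omega>). \<Psi> s \<omega> (g j)) \<in> borel_measurable (predictable_sigma M F t)"
    and I[measurable]: "I \<in> borel_measurable M"
    using SI by (auto simp: has_stoch_integral_def)
  obtain n \<tau> \<Phi> where "\<forall>m. elementary F t (n m) (\<tau> m) (\<Phi> m :: nat \<Rightarrow> 'w \<Rightarrow> 'u \<Rightarrow>\<^sub>L 'h)"
    and "\<forall>\<epsilon>>0. (\<lambda>m. measure M {\<omega> \<in> space M.
            (\<integral>\<^sup>+s\<in>{0..t}. (\<Sum>j. ennreal ((norm
                (elem_process (n m) (\<tau> m) (\<Phi> m) s \<omega> (g j) - \<Psi> s \<omega> (g j)))\<^sup>2)) \<partial>lborel)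
              > ennreal \<epsilon>}) \<longlonglongrightarrow> 0"
    and "\<forall>\<epsilon>>0. (\<lambda>m. measure M {\<omega> \<in> space M.
            norm (elem_integral W (n m) (\<tau> m) (\<Phi> m) \<omega> - I \<omega>) > \<epsilon>}) \<longlonglongrightarrow> 0"
    using SI unfolding has_stoch_integral_def by (elim conjE exE) (rule that)
  note el = this(1)[rule_format] and lim1 = this(2)[rule_format] and lim2 = this(3)[rule_format]
  define EP where "EP m s \<omega> j = elem_process (n m) (\<tau> m) (\<Phi> m) s \<omega> (g j)" for m s \<omega> j
  define J where "J m \<omega> = elem_integral W (n m) (\<tau> m) (\<Phi> m) \<omega>" for m \<omega>
  define D where "D m \<omega> = (\<integral>\<^sup>+s\<in>{0..t}. (\<Sum>j. ennreal ((norm (EP m s \<omega> j - \<Psi> s \<omega> (g j)))\<^sup>2)) \<partial>lborel)" for m \<omega>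
  \<comment> \<open>The integrand is predictable on \<open>{0..t}\<close> only; \<open>P\<close> is
    its jointly measurable extension by zero, in terms of which \<open>V\<close> and
    \<open>D m\<close> are time integrals of sections.\<close>
  define P where "P j x = indicator {0..t} (fst x) *\<^sub>R \<Psi> (fst x) (snd x) (g j)" for j x
  have P[measurable]: "P j \<in> borel_measurable (lborel \<Otimes>\<^sub>M M)" for j
    using predictable_measurable[OF t pred[of j]] by (simp add: P_def[abs_def] split_beta')
  have EP[measurable]: "(\<lambda>x. EP m (fst x) (snd x) j) \<in> borel_measurable (lborel \<Otimes>\<^sub>M M)" for m j
  proof -
    have "(\<lambda>x. indicator {\<tau> m k<..\<tau> m (Suc k)} (fst x) *\<^sub>R \<Phi> m k (snd x) (g j)) \<in> borel_measurable (lborel \<Otimes>\<^sub>M M)"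
      if "k < n m" for k
    proof -
      have [measurable]: "(\<lambda>\<omega>. \<Phi> m k \<omega> (g j)) \<in> borel_measurable M"
        by (rule elementary_apply_measurable_M[OF el that t(2)])
      show ?thesis by measurable
    qed
    then show ?thesis unfolding EP_def elem_process_def by (intro borel_measurable_sum) auto
  qed
  have J[measurable]: "J m \<in> borel_measurable M" for m
    unfolding J_def[abs_def] using elementary_integral_measurable[OF el t(2)] by simp
  have P_eq: "P j (s, \<omega>) = \<Psi> s \<omega> (g j)" if "s \<in> {0..t}" for j s \<omega>
    using that by (simp add: P_def)
  have V_eq: "V = (\<lambda>\<omega>. \<integral>\<^sup>+s. (\<lambda>x. (\<Sum>j. ennreal ((norm (P j x))\<^sup>2)) * indicator {0..t} (fst x)) (s, \<omega>) \<partial>lborel)"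
    unfolding V_def
  proof (intro ext nn_integral_cong)
    fix \<omega> s
    show "(\<Sum>j. ennreal ((norm (\<Psi> s \<omega> (g j)))\<^sup>2)) * indicator {0..t} s =
      (\<Sum>j. ennreal ((norm (P j (s, \<omega>)))\<^sup>2)) * indicator {0..t} (fst (s, \<omega>))"
    proof (cases "s \<in> {0..t}")
      case True
      show ?thesis unfolding P_eq[OF True] fst_conv ..
    qed simp
  qed
  show V[measurable]: "V \<in> borel_measurable M"
    unfolding V_eq by (rule nn_integral_section_measurable) measurable
  have D_eq: "D m = (\<lambda>\<omega>. \<integral>\<^sup>+s. (\<lambda>x. (\<Sum>j. ennreal ((norm (EP m (fst x) (snd x) j - P j x))\<^sup>2)) * indicator {0..t} (fst x)) (s, \<omega>) \<partial>lborel)" for m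
    unfolding D_def[abs_def]
  proof (intro ext nn_integral_cong)
    fix \<omega> s
    show "(\<Sum>j. ennreal ((norm (EP m s \<omega> j - \<Psi> s \<omega> (g j)))\<^sup>2)) * indicator {0..t} s =
      (\<Sum>j. ennreal ((norm (EP m (fst (s, \<omega>)) (snd (s, \<omega>)) j - P j (s, \<omega>)))\<^sup>2)) * indicator {0..t} (fst (s, \<omega>))"
    proof (cases "s \<in> {0..t}")
      case True
      show ?thesis unfolding P_eq[OF True] fst_conv snd_conv ..
    qed simp
  qed
  have D[measurable]: "D m \<in> borel_measurable M" for m
    unfolding D_eq by (rule nn_integral_section_measurable) measurable
  \<comment> \<open>From the square inequality \<open>ennreal_norm_power2_le\<close>, summed over
    \<open>j\<close> and integrated in time.\<close>
  have qv: "quadratic_variation (n m) (\<tau> m) (\<Phi> m) \<omega> \<le> 2 * V \<omega> + 2 * D m \<omega>" if \<omega>: "\<omega> \<in> space M" for m \<omega>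
  proof -
    have sec: "(\<lambda>s. f (s, \<omega>)) \<in> borel_measurable lborel" if "f \<in> borel_measurable (lborel \<Otimes>\<^sub>M M)" for f :: "real \<times> 'w \<Rightarrow> ennreal"
      using measurable_Pair1[OF that \<omega>] .
    have m1: "(\<lambda>s. (\<lambda>x. (\<Sum>j. ennreal ((norm (P j x))\<^sup>2)) * indicator {0..t} (fst x)) (s, \<omega>)) \<in> borel_measurable lborel"
      by (rule sec) measurable
    have m2: "(\<lambda>s. (\<lambda>x. (\<Sum>j. ennreal ((norm (EP m (fst x) (snd x) j - P j x))\<^sup>2)) * indicator {0..t} (fst x)) (s, \<omega>)) \<in> borel_measurable lborel"
      by (rule sec) measurable
    have "quadratic_variation (n m) (\<tau> m) (\<Phi> m) \<omega> \<le>
      (\<integral>\<^sup>+s\<in>{0..t}. (\<Sum>j. ennreal ((norm (EP m s \<omega> j))\<^sup>2)) \<partial>lborel)"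
      unfolding EP_def by (rule quadratic_variation_le[OF el])
    also have "\<dots> \<le> (\<integral>\<^sup>+s. 2 * (\<lambda>x. (\<Sum>j. ennreal ((norm (P j x))\<^sup>2)) * indicator {0..t} (fst x)) (s, \<omega>)
       + 2 * (\<lambda>x. (\<Sum>j. ennreal ((norm (EP m (fst x) (snd x) j - P j x))\<^sup>2)) * indicator {0..t} (fst x)) (s, \<omega>) \<partial>lborel)"
    proof (rule nn_integral_mono)
      fix s
      have "(\<Sum>j. ennreal ((norm (EP m s \<omega> j))\<^sup>2)) \<le>
        (\<Sum>j. 2 * ennreal ((norm (P j (s, \<omega>)))\<^sup>2) + 2 * ennreal ((norm (EP m s \<omega> j - P j (s, \<omega>)))\<^sup>2))"
        by (intro suminf_le allI ennreal_norm_power2_le) auto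
      also have "\<dots> = 2 * (\<Sum>j. ennreal ((norm (P j (s, \<omega>)))\<^sup>2)) + 2 * (\<Sum>j. ennreal ((norm (EP m s \<omega> j - P j (s, \<omega>)))\<^sup>2))"
        by (subst suminf_add[symmetric]) auto
      finally show "(\<Sum>j. ennreal ((norm (EP m s \<omega> j))\<^sup>2)) * indicator {0..t} s \<le>
        2 * (\<lambda>x. (\<Sum>j. ennreal ((norm (P j x))\<^sup>2)) * indicator {0..t} (fst x)) (s, \<omega>)
       + 2 * (\<lambda>x. (\<Sum>j. ennreal ((norm (EP m (fst x) (snd x) j - P j x))\<^sup>2)) * indicator {0..t} (fst x)) (s, \<omega>)"
        by (cases "s \<in> {0..t}") simp_all
    qed
    also have "\<dots> = 2 * V \<omega> + 2 * D m \<omega>"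
      unfolding V_eq D_eq using m1 m2 by (simp add: nn_integral_add nn_integral_cmult)
    finally show ?thesis .
  qed
  \<comment> \<open>One sequence for both modes of convergence, so that a single subsequence serves
    both. The cap precedes \<open>enn2real\<close> because \<open>enn2real\<close> sends infinity to
    0 and would hide an infinite \<open>D m \<omega>\<close>.\<close>
  define Z where "Z m \<omega> = enn2real (min 1 (D m \<omega>)) + norm (J m \<omega> - I \<omega>)" for m \<omega>
  have "\<exists>r::nat\<Rightarrow>nat. strict_mono r \<and> (AE \<omega> in M. (\<lambda>m. Z (r m) \<omega>) \<longlonglongrightarrow> 0)"
  proof (rule tendsto_probability_AE_subseq)
    show "Z m \<in> borel_measurable M" for m unfolding Z_def[abs_def] by measurable
    show "0 \<le> Z m \<omega>" for m \<omega> by (simp add: Z_def)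
    fix \<epsilon> :: real assume \<epsilon>: "\<epsilon> > 0"
    have sub: "prob {\<omega>\<in>space M. Z m \<omega> > \<epsilon>} \<le>
      prob {\<omega>\<in>space M. D m \<omega> > ennreal (\<epsilon>/2)} + prob {\<omega>\<in>space M. norm (J m \<omega> - I \<omega>) > \<epsilon>/2}" for m
    proof -
      have small: "enn2real (min 1 (D m \<omega>)) \<le> \<epsilon>/2" if "D m \<omega> \<le> ennreal (\<epsilon>/2)" for \<omega>
        using \<epsilon> that by (intro enn2real_leI) (auto simp: min.coboundedI2)
      have "D m \<omega> > ennreal (\<epsilon>/2) \<or> norm (J m \<omega> - I \<omega>) > \<epsilon>/2" if "Z m \<omega> > \<epsilon>" for \<omega>
        using small[of \<omega>] that unfolding Z_def by (cases "D m \<omega> \<le> ennreal (\<epsilon>/2)") (linarith, simp add: not_le)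
      then have "{\<omega>\<in>space M. Z m \<omega> > \<epsilon>} \<subseteq> {\<omega>\<in>space M. D m \<omega> > ennreal (\<epsilon>/2)} \<union> {\<omega>\<in>space M. norm (J m \<omega> - I \<omega>) > \<epsilon>/2}"
        by blast
      then have "prob {\<omega>\<in>space M. Z m \<omega> > \<epsilon>} \<le> prob ({\<omega>\<in>space M. D m \<omega> > ennreal (\<epsilon>/2)} \<union> {\<omega>\<in>space M. norm (J m \<omega> - I \<omega>) > \<epsilon>/2})"
        by (intro finite_measure_mono) measurable
      also have "\<dots> \<le> prob {\<omega>\<in>space M. D m \<omega> > ennreal (\<epsilon>/2)} + prob {\<omega>\<in>space M. norm (J m \<omega> - I \<omega>) > \<epsilon>/2}"
        by (intro measure_Un_le) measurable
      finally show ?thesis .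
    qed
    have "(\<lambda>m. prob {\<omega>\<in>space M. D m \<omega> > ennreal (\<epsilon>/2)} + prob {\<omega>\<in>space M. norm (J m \<omega> - I \<omega>) > \<epsilon>/2}) \<longlonglongrightarrow> 0 + 0"
      unfolding D_def EP_def J_def by (rule tendsto_add[OF lim1 lim2]) (use \<epsilon> in simp_all)
    then show "(\<lambda>m. prob {\<omega>\<in>space M. Z m \<omega> > \<epsilon>}) \<longlonglongrightarrow> 0"
      unfolding add_0_right
      by (rule tendsto_sandwich[OF always_eventually always_eventually tendsto_const, rotated 2])
        (intro allI measure_nonneg sub)+
  qed
  then obtain r :: "nat \<Rightarrow> nat" where r: "AE \<omega> in M. (\<lambda>m. Z (r m) \<omega>) \<longlonglongrightarrow> 0" by auto
  have conv: "AE \<omega> in M. (\<lambda>m. D (r m) \<omega>) \<longlonglongrightarrow> 0 \<and> (\<lambda>m. J (r m) \<omega>) \<longlonglongrightarrow> I \<omega>"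
    using r
  proof eventually_elim
    case (elim \<omega>)
    have n0: "(\<lambda>m. norm (J (r m) \<omega> - I \<omega>)) \<longlonglongrightarrow> 0"
      by (rule tendsto_sandwich[OF _ _ tendsto_const elim]) (auto simp: Z_def)
    have "(\<lambda>m. enn2real (min 1 (D (r m) \<omega>))) \<longlonglongrightarrow> 0"
      by (rule tendsto_sandwich[OF _ _ tendsto_const elim]) (auto simp: Z_def)
    then have "(\<lambda>m. ennreal (enn2real (min 1 (D (r m) \<omega>)))) \<longlonglongrightarrow> ennreal 0" by (rule tendsto_ennrealI)
    moreover have "ennreal (enn2real (min 1 (D (r m) \<omega>))) = min 1 (D (r m) \<omega>)" for m
      by (rule ennreal_enn2real) (simp add: min_less_iff_disj)
    ultimately have mn: "(\<lambda>m. min 1 (D (r m) \<omega>)) \<longlonglongrightarrow> 0" by simp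
    then have "eventually (\<lambda>m. min 1 (D (r m) \<omega>) < 1) sequentially"
      by (rule order_tendstoD) simp
    then have "eventually (\<lambda>m. min 1 (D (r m) \<omega>) = D (r m) \<omega>) sequentially"
      by eventually_elim (auto simp: min_def split: if_splits)
    with mn have "(\<lambda>m. D (r m) \<omega>) \<longlonglongrightarrow> 0" by (rule Lim_transform_eventually)
    moreover have "(\<lambda>m. J (r m) \<omega>) \<longlonglongrightarrow> I \<omega>" using n0 by (simp add: tendsto_norm_zero_iff LIM_zero_iff)
    ultimately show ?case by simp
  qed
  \<comment> \<open>When \<open>V\<close> is at most R and \<open>D\<close> is below R/2, the bound
    \<open>qv\<close> gives at most 2R + R. The same 3 is the factor in the conclusion.\<close>
  let ?R3 = "ennreal (3 * R)"
  define J' where "J' m \<omega> = elem_integral W (n m) (\<tau> m) (truncate ?R3 (\<tau> m) (\<Phi> m)) \<omega>" for m \<omega>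
  have J'[measurable]: "J' m \<in> borel_measurable M" for m
    unfolding J'_def[abs_def] using elementary_integral_measurable[OF elementary_truncate[OF el t(2)] t(2)] by simp
  have J'_bound: "(\<integral>\<^sup>+\<omega>. ennreal ((norm (J' m \<omega>))\<^sup>2) \<partial>M) \<le> (\<integral>\<^sup>+\<omega>. min ?R3 (2 * V \<omega> + 2 * D m \<omega>) \<partial>M)" for m
  proof -
    have "(\<integral>\<^sup>+\<omega>. ennreal ((norm (J' m \<omega>))\<^sup>2) \<partial>M) \<le>
      (\<integral>\<^sup>+\<omega>. quadratic_variation (n m) (\<tau> m) (truncate ?R3 (\<tau> m) (\<Phi> m)) \<omega> \<partial>M)"
      unfolding J'_def by (rule elementary_integral_L2_bound[OF elementary_truncate[OF el t(2)] t(2)])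
    also have "\<dots> \<le> (\<integral>\<^sup>+\<omega>. min ?R3 (2 * V \<omega> + 2 * D m \<omega>) \<partial>M)"
      by (intro nn_integral_mono order_trans[OF quadratic_variation_truncate] min.mono order_refl qv)
    finally show ?thesis .
  qed
  have "(\<integral>\<^sup>+\<omega>. ennreal ((norm (I \<omega>))\<^sup>2) * indicator {\<omega>. V \<omega> \<le> ennreal R} \<omega> \<partial>M) \<le>
    (\<integral>\<^sup>+\<omega>. liminf (\<lambda>m. ennreal ((norm (J' (r m) \<omega>))\<^sup>2)) \<partial>M)"
  proof (rule nn_integral_mono_AE)
    show "AE \<omega> in M. ennreal ((norm (I \<omega>))\<^sup>2) * indicator {\<omega>. V \<omega> \<le> ennreal R} \<omega> \<le>
      liminf (\<lambda>m. ennreal ((norm (J' (r m) \<omega>))\<^sup>2))"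
      using conv AE_space
    proof eventually_elim
      case (elim \<omega>)
      show ?case
      proof (cases "V \<omega> \<le> ennreal R")
        case True
        have "eventually (\<lambda>m. D (r m) \<omega> < ennreal (R/2)) sequentially"
          using elim R by (intro order_tendstoD(2)[of _ 0]) auto
        then have "eventually (\<lambda>m. J (r m) \<omega> = J' (r m) \<omega>) sequentially"
        proof eventually_elim
          case (elim m)
          have "quadratic_variation (n (r m)) (\<tau> (r m)) (\<Phi> (r m)) \<omega> \<le> 2 * V \<omega> + 2 * D (r m) \<omega>"
            by (rule qv) fact
          also have "\<dots> \<le> 2 * ennreal R + 2 * ennreal (R/2)"
            using True elim by (intro add_mono mult_left_mono) auto
          also have "\<dots> = ennreal (2 * R + 2 * (R/2))" 
            using R by (simp only: ennreal_plus ennreal_mult) (simp add: ennreal_mult ennreal_plus)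
          finally have "quadratic_variation (n (r m)) (\<tau> (r m)) (\<Phi> (r m)) \<omega> \<le> ?R3" by simp
          then show ?case unfolding J_def J'_def by (rule elem_integral_truncate[symmetric])
        qed
        with elim have "(\<lambda>m. J' (r m) \<omega>) \<longlonglongrightarrow> I \<omega>" by (blast intro: Lim_transform_eventually)
        then have "(\<lambda>m. ennreal ((norm (J' (r m) \<omega>))\<^sup>2)) \<longlonglongrightarrow> ennreal ((norm (I \<omega>))\<^sup>2)"
          by (intro tendsto_ennrealI tendsto_power tendsto_norm)
        then have "liminf (\<lambda>m. ennreal ((norm (J' (r m) \<omega>))\<^sup>2)) = ennreal ((norm (I \<omega>))\<^sup>2)"
          by (intro lim_imp_Liminf) auto
        then show ?thesis by (simp add: indicator_def)
      qed simp
    qed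
  qed
  also have "\<dots> \<le> liminf (\<lambda>m. \<integral>\<^sup>+\<omega>. ennreal ((norm (J' (r m) \<omega>))\<^sup>2) \<partial>M)"
    by (rule nn_integral_liminf) measurable
  also have "\<dots> \<le> liminf (\<lambda>m. \<integral>\<^sup>+\<omega>. min ?R3 (2 * V \<omega> + 2 * D (r m) \<omega>) \<partial>M)"
    by (intro Liminf_mono always_eventually allI J'_bound)
  \<comment> \<open>The constant majorant comes from the cut; \<open>V\<close> and \<open>D\<close>
    themselves need not be integrable.\<close>
  also have "\<dots> = (\<integral>\<^sup>+\<omega>. min ?R3 (2 * V \<omega>) \<partial>M)"
  proof (rule lim_imp_Liminf)
    show "(\<lambda>m. \<integral>\<^sup>+\<omega>. min ?R3 (2 * V \<omega> + 2 * D (r m) \<omega>) \<partial>M) \<longlonglongrightarrow> (\<integral>\<^sup>+\<omega>. min ?R3 (2 * V \<omega>) \<partial>M)"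
    proof (rule nn_integral_dominated_convergence[where w="\<lambda>_. ?R3"])
      show "AE \<omega> in M. (\<lambda>m. min ?R3 (2 * V \<omega> + 2 * D (r m) \<omega>)) \<longlonglongrightarrow> min ?R3 (2 * V \<omega>)"
        using conv
      proof eventually_elim
        case (elim \<omega>)
        then have "(\<lambda>m. min ?R3 (2 * V \<omega> + 2 * D (r m) \<omega>)) \<longlonglongrightarrow> min ?R3 (2 * V \<omega> + 2 * 0)"
          by (intro tendsto_min tendsto_add tendsto_const ennreal_tendsto_cmult) auto
        then show ?case by simp
      qed
    qed (auto simp: emeasure_space_1)
  qed simp
  also have "\<dots> \<le> (\<integral>\<^sup>+\<omega>. 3 * min (ennreal R) (V \<omega>) \<partial>M)"
  proof (rule nn_integral_mono)
    fix \<omega>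
    have "?R3 = 3 * ennreal R" using R by (simp add: ennreal_mult)
    moreover have "2 * V \<omega> \<le> 3 * V \<omega>" by (intro mult_right_mono) auto
    ultimately show "min ?R3 (2 * V \<omega>) \<le> 3 * min (ennreal R) (V \<omega>)"
      by (auto simp: min_def)
  qed
  also have "\<dots> = 3 * (\<integral>\<^sup>+\<omega>. min (ennreal R) (V \<omega>) \<partial>M)"
    by (intro nn_integral_cmult) measurable
  finally show "(\<integral>\<^sup>+\<omega>. ennreal ((norm (I \<omega>))\<^sup>2) * indicator {\<omega>. V \<omega> \<le> ennreal R} \<omega> \<partial>M)
      \<le> 3 * (\<integral>\<^sup>+\<omega>. min (ennreal R) (V \<omega>) \<partial>M)" .
qed

end

section \<open>Mild solutions\<close>

lemma norm_lebesgue_integral_le: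
  fixes f :: "'a \<Rightarrow> 'b::{real_normed_vector,second_countable_topology}"
  shows "ennreal (norm (integral\<^sup>L M f)) \<le> (\<integral>\<^sup>+x. ennreal (norm (f x)) \<partial>M)"
  \<comment> \<open>Outside the integrable case the Bochner integral is 0 by convention, so the
    bound persists.\<close>
  by (cases "integrable M f") (simp_all add: integral_norm_bound_ennreal not_integrable_integral_eq)

lemma nn_integral_Icc_eq_integral:
  fixes c :: "real \<Rightarrow> real"
  assumes c: "continuous_on {0..t} c" and nonneg: "\<And>s. 0 \<le> c s"
  shows "(\<integral>\<^sup>+s\<in>{0..t}. ennreal (c s) \<partial>lborel) = ennreal (integral {0..t} c)"
proof -
  have int: "set_integrable lborel {0..t} c" by (rule borel_integrable_atLeastAtMost'[OF c])
  have "(\<integral>\<^sup>+s\<in>{0..t}. ennreal (c s) \<partial>lborel) = (\<integral>\<^sup>+s. ennreal (indicator {0..t} s *\<^sub>R c s) \<partial>lborel)"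
    by (intro nn_integral_cong) (simp split: split_indicator)
  also have "\<dots> = ennreal (LINT s:{0..t}|lborel. c s)"
    unfolding set_lebesgue_integral_def using int nonneg
    by (intro nn_integral_eq_integral) (auto simp: set_integrable_def)
  finally show ?thesis using set_borel_integral_eq_integral(2)[OF int] by simp
qed

text \<open>\<open>Y\<close> is continuous and starts at 0. If it ends above \<open>R\<close>, it
  equals \<open>R\<close> at some time \<open>r\<close>; up to \<open>r\<close> the indicator is 1,
  so the right side is at least \<open>Y r\<close>. A jump across \<open>R\<close> would break
  this.\<close>

lemma min_primitive_le:
  fixes c :: "real \<Rightarrow> real"
  assumes c: "continuous_on UNIV c" and nonneg: "\<And>s. 0 \<le> c s" and R: "0 \<le> R" and t: "0 \<le> t"
  defines "Y \<equiv> \<lambda>t. \<integral>\<^sup>+s\<in>{0..t}. ennreal (c s) \<partial>lborel"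
  shows "min (ennreal R) (Y t) \<le> (\<integral>\<^sup>+s\<in>{0..t}. ennreal (c s) * indicator {s. Y s \<le> ennreal R} s \<partial>lborel)"
proof -
  have Y: "Y s = ennreal (integral {0..s} c)" for s
    unfolding Y_def by (intro nn_integral_Icc_eq_integral nonneg continuous_on_subset[OF c]) simp
  have mono: "Y s \<le> Y r" if "s \<le> r" for s r
    unfolding Y_def using that by (intro nn_integral_mono) (auto split: split_indicator)
  have reach: "Y r \<le> (\<integral>\<^sup>+s\<in>{0..t}. ennreal (c s) * indicator {s. Y s \<le> ennreal R} s \<partial>lborel)"
    if "0 \<le> r" "r \<le> t" "Y r \<le> ennreal R" for r
  proof -
    have "Y r = (\<integral>\<^sup>+s\<in>{0..r}. ennreal (c s) \<partial>lborel)" unfolding Y_def ..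
    also have "\<dots> \<le> (\<integral>\<^sup>+s\<in>{0..t}. ennreal (c s) * indicator {s. Y s \<le> ennreal R} s \<partial>lborel)"
    proof (intro nn_integral_mono)
      fix s
      show "ennreal (c s) * indicator {0..r} s \<le>
        ennreal (c s) * indicator {s. Y s \<le> ennreal R} s * indicator {0..t} s"
        using mono[of s r] that by (auto split: split_indicator intro: order_trans)
    qed
    finally show ?thesis .
  qed
  show ?thesis
  proof (cases "Y t \<le> ennreal R")
    case True
    with reach[of t] t show ?thesis by (simp add: min.coboundedI2)
  next
    case False
    then have "R \<le> integral {0..t} c" unfolding Y by (simp add: not_le ennreal_less_iff R less_imp_le)
    moreover have "continuous_on {0..t} (\<lambda>s. integral {0..s} c)"
      by (intro indefinite_integral_continuous_1 integrable_continuous_real continuous_on_subset[OF c]) simp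
    ultimately obtain r where r: "0 \<le> r" "r \<le> t" "integral {0..r} c = R"
      using IVT'[of "\<lambda>s. integral {0..s} c" 0 R t] R t by auto
    then have "ennreal R = Y r" by (simp add: Y)
    with reach[of r] r show ?thesis by (simp add: min.coboundedI1)
  qed
qed

text \<open>A mild solution is measurable at each fixed time and continuous only almost surely,
  whereas Fubini's theorem requires measurability in time and outcome jointly. Paths that are
  continuous without exception provide it, by sampling on finer and finer grids.\<close>

lemma continuous_modification:
  fixes X :: "real \<Rightarrow> 'w \<Rightarrow> 'b::{real_normed_vector,second_countable_topology}"
  assumes T: "0 \<le> T" and meas: "\<And>t. 0 \<le> t \<Longrightarrow> t \<le> T \<Longrightarrow> X t \<in> borel_measurable M"
    and cont: "AE \<omega> in M. continuous_on {0..T} (\<lambda>t. X t \<omega>)"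
  obtains Z where "\<And>\<omega>. \<omega> \<in> space M \<Longrightarrow> continuous_on UNIV (\<lambda>s. Z s \<omega>)"
    "(\<lambda>x. Z (fst x) (snd x)) \<in> borel_measurable (lborel \<Otimes>\<^sub>M M)"
    "AE \<omega> in M. \<forall>s\<in>{0..T}. Z s \<omega> = X s \<omega>"
proof -
  \<comment> \<open>The set of discontinuous paths is enclosed in a measurable null set.\<close>
  obtain N where N: "{\<omega>\<in>space M. \<not> continuous_on {0..T} (\<lambda>t. X t \<omega>)} \<subseteq> N" "N \<in> null_sets M"
    using AE_E[OF cont] unfolding null_sets_def by blast
  \<comment> \<open>Clipping freezes each path outside \<open>{0..T}\<close>, which makes it
    continuous on the whole line.\<close>
  define clip where "clip s = max 0 (min T s)" for s :: real
  have clip: "0 \<le> clip s" "clip s \<le> T" for s using T by (auto simp: clip_def)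
  have clip_id: "clip s = s" if "s \<in> {0..T}" for s using that by (simp add: clip_def)
  have clip_cont: "continuous_on A clip" for A unfolding clip_def by (intro continuous_intros)
  define Z where "Z s \<omega> = (if \<omega> \<in> N then 0 else X (clip s) \<omega>)" for s \<omega>
  have Zc: "continuous_on UNIV (\<lambda>s. Z s \<omega>)" if "\<omega> \<in> space M" for \<omega>
  proof (cases "\<omega> \<in> N")
    case True
    then show ?thesis by (simp add: Z_def)
  next
    case False
    then have "continuous_on {0..T} (\<lambda>t. X t \<omega>)" using N that by auto
    then have "continuous_on UNIV (\<lambda>s. X (clip s) \<omega>)"
      by (rule continuous_on_compose2[OF _ clip_cont]) (use clip in auto)
    then show ?thesis using False by (simp add: Z_def)
  qed
  have N_sets: "N \<in> sets M" using N by auto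
  have Zm: "Z s \<in> borel_measurable M" for s
    unfolding Z_def[abs_def] using N_sets meas[OF clip] by (intro measurable_If_set) auto
  have Zj: "(\<lambda>x. Z (fst x) (snd x)) \<in> borel_measurable (lborel \<Otimes>\<^sub>M M)"
  proof (rule borel_measurable_LIMSEQ_metric)
    fix n :: nat
    \<comment> \<open>The rounded time takes countably many values, so measurability follows from
      that of each \<open>Z s\<close>. The mesh is \<open>1 / real (Suc n)\<close>, with
      \<open>Suc\<close> to avoid division by zero.\<close>
    show "(\<lambda>x. Z (of_int \<lfloor>real (Suc n) * fst x\<rfloor> / real (Suc n)) (snd x)) \<in> borel_measurable (lborel \<Otimes>\<^sub>M M)"
    proof (rule measurable_compose_countable'[where I=UNIV and f="\<lambda>i x. Z (of_int i / real (Suc n)) (snd x)"])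
      show "(\<lambda>x. Z (of_int i / real (Suc n)) (snd x)) \<in> borel_measurable (lborel \<Otimes>\<^sub>M M)" for i
        by (rule measurable_compose[OF measurable_snd Zm])
      show "(\<lambda>x. \<lfloor>real (Suc n) * fst x\<rfloor>) \<in> lborel \<Otimes>\<^sub>M M \<rightarrow>\<^sub>M count_space UNIV"
        by measurable
    qed simp
  next
    fix x :: "real \<times> 'w" assume "x \<in> space (lborel \<Otimes>\<^sub>M M)"
    then have "snd x \<in> space M" by (auto simp: space_pair_measure)
    then have "isCont (\<lambda>s. Z s (snd x)) (fst x)"
      using Zc[of "snd x"] by (simp add: continuous_on_eq_continuous_at)
    moreover have "(\<lambda>n. of_int \<lfloor>real (Suc n) * fst x\<rfloor> / real (Suc n)) \<longlonglongrightarrow> fst x"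
    proof (rule LIMSEQ_I)
      fix d :: real assume "d > 0"
      then obtain n0 where n0: "inverse (real (Suc n0)) < d" using reals_Archimedean by blast
      show "\<exists>no. \<forall>n\<ge>no. norm (of_int \<lfloor>real (Suc n) * fst x\<rfloor> / real (Suc n) - fst x) < d"
      proof (intro exI allI impI)
        fix n assume n: "n0 \<le> n"
        have "\<bar>of_int \<lfloor>real (Suc n) * fst x\<rfloor> - real (Suc n) * fst x\<bar> \<le> 1" by linarith
        then have "\<bar>of_int \<lfloor>real (Suc n) * fst x\<rfloor> - real (Suc n) * fst x\<bar> / real (Suc n) \<le> 1 / real (Suc n)"
          by (intro divide_right_mono) auto
        moreover have "of_int \<lfloor>real (Suc n) * fst x\<rfloor> / real (Suc n) - fst x =
          (of_int \<lfloor>real (Suc n) * fst x\<rfloor> - real (Suc n) * fst x) / real (Suc n)"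
          by (simp add: diff_divide_distrib del: of_nat_Suc)
        moreover have "1 / real (Suc n) \<le> inverse (real (Suc n0))"
          using n by (simp add: divide_inverse le_imp_inverse_le)
        ultimately show "norm (of_int \<lfloor>real (Suc n) * fst x\<rfloor> / real (Suc n) - fst x) < d"
          using n0 by (simp add: abs_divide del: of_nat_Suc)
      qed
    qed
    ultimately show "(\<lambda>n. Z (of_int \<lfloor>real (Suc n) * fst x\<rfloor> / real (Suc n)) (snd x)) \<longlonglongrightarrow> Z (fst x) (snd x)"
      by (rule isCont_tendsto_compose)
  qed
  have "AE \<omega> in M. \<forall>s\<in>{0..T}. Z s \<omega> = X s \<omega>"
    using AE_not_in[OF N(2)] by eventually_elim (simp add: Z_def clip_id)
  with Zc Zj show ?thesis using that by blast
qed

lemma norm_add3_power2_le: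
  fixes a b c :: "'b::real_normed_vector"
  shows "(norm (a + b + c))\<^sup>2 \<le> 3 * (norm a)\<^sup>2 + 3 * (norm b)\<^sup>2 + 3 * (norm c)\<^sup>2"
proof -
  have "norm (a + b + c) \<le> norm a + norm b + norm c"
    by (meson add_mono_thms_linordered_semiring(3) norm_triangle_ineq order_trans)
  then have "(norm (a + b + c))\<^sup>2 \<le> (norm a + norm b + norm c)\<^sup>2" by (intro power_mono) auto
  also have "\<dots> \<le> 3 * (norm a)\<^sup>2 + 3 * (norm b)\<^sup>2 + 3 * (norm c)\<^sup>2"
    using zero_le_power2[of "norm a - norm b"] zero_le_power2[of "norm a - norm c"] zero_le_power2[of "norm b - norm c"]
    unfolding power2_eq_square by (simp add: algebra_simps)
  finally show ?thesis .
qed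

text \<open>Matches truncation levels: a quantity dominated by c times \<open>y\<close> is capped at
  cR when \<open>y\<close> is capped at R.\<close>

lemma min_mult_le_ennreal:
  assumes "c \<ge> 0" "R \<ge> 0" "v \<le> ennreal c * y"
  shows "min (ennreal (c * R)) v \<le> ennreal c * min (ennreal R) y"
proof (cases "ennreal R \<le> y")
  case True
  then show ?thesis using assms by (simp add: ennreal_mult min_absorb1)
next
  case False
  then show ?thesis using assms by (simp add: min_absorb2 min.coboundedI2)
qed

text \<open>Cauchy-Schwarz in time against the constant \<open>a\<close>. The factor
  \<open>t * a\<^sup>2\<close> is the squared norm of that constant, and what remains is the same
  integral that dominates the stochastic term.\<close>

lemma drift_bound:
  fixes f :: "real \<Rightarrow> 'b::{real_normed_vector,second_countable_topology}"
  assumes f: "\<And>s. s \<in> {0..t} \<Longrightarrow> norm (f s) \<le> a * z s" and z[measurable]: "z \<in> borel_measurable borel" and nonneg: "\<And>s. 0 \<le> z s"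
    and a: "0 \<le> a" and t: "0 \<le> t"
  shows "ennreal ((norm (LINT s:{0..t}|lborel. f s))\<^sup>2) \<le> ennreal (t * a\<^sup>2) * (\<integral>\<^sup>+s\<in>{0..t}. ennreal ((z s)\<^sup>2) \<partial>lborel)"
proof -
  have "ennreal (norm (LINT s:{0..t}|lborel. f s)) \<le> (\<integral>\<^sup>+s. ennreal (norm (indicator {0..t} s *\<^sub>R f s)) \<partial>lborel)"
    unfolding set_lebesgue_integral_def by (rule norm_lebesgue_integral_le)
  also have "\<dots> \<le> (\<integral>\<^sup>+s. ennreal (a * indicator {0..t} s) * ennreal (z s * indicator {0..t} s) \<partial>lborel)"
    using f a nonneg by (intro nn_integral_mono) (auto split: split_indicator simp: ennreal_mult[symmetric] intro!: ennreal_leI)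
  finally have "(ennreal (norm (LINT s:{0..t}|lborel. f s)))\<^sup>2 \<le>
    (\<integral>\<^sup>+s. ennreal (a * indicator {0..t} s) * ennreal (z s * indicator {0..t} s) \<partial>lborel)\<^sup>2"
    by (rule power_mono) simp
  also have "\<dots> \<le> (\<integral>\<^sup>+s. (ennreal (a * indicator {0..t} s))\<^sup>2 \<partial>lborel) * (\<integral>\<^sup>+s. (ennreal (z s * indicator {0..t} s))\<^sup>2 \<partial>lborel)"
    by (rule Cauchy_Schwarz_nn_integral) measurable
  also have "(\<integral>\<^sup>+s. (ennreal (a * indicator {0..t} s))\<^sup>2 \<partial>lborel) = (\<integral>\<^sup>+s. ennreal (a\<^sup>2) * indicator {0..t} s \<partial>lborel)"
    using a by (intro nn_integral_cong) (simp add: ennreal_power split: split_indicator)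
  also have "\<dots> = ennreal (t * a\<^sup>2)"
    using t a by (subst nn_integral_cmult_indicator) (auto simp: ennreal_mult mult.commute)
  also have "(\<integral>\<^sup>+s. (ennreal (z s * indicator {0..t} s))\<^sup>2 \<partial>lborel) = (\<integral>\<^sup>+s\<in>{0..t}. ennreal ((z s)\<^sup>2) \<partial>lborel)"
    using nonneg by (intro nn_integral_cong) (simp add: ennreal_power split: split_indicator)
  finally show ?thesis by (simp add: ennreal_power)
qed

section \<open>Mean square displacement from the initial value\<close>

context wiener_integral
begin

text \<open>The displacement splits into \<open>S t x - x\<close>, the drift \<open>D\<close> and
  the stochastic convolution \<open>I\<close>. Since \<open>Y t\<close> dominates both the squared
  drift and \<open>V\<close>, the single event that \<open>Y t\<close> is at most \<open>R\<close>
  controls all of it.\<close>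

lemma mild_solution_truncated_displacement:
  fixes S :: "real \<Rightarrow> 'h::{real_inner,complete_space,second_countable_topology} \<Rightarrow>\<^sub>L 'h"
    and Z :: "real \<Rightarrow> 'w \<Rightarrow> 'h"
  assumes mild: "mild_solution M T F Q g W S \<alpha> \<sigma> x X"
    and S: "\<And>t. 0 \<le> t \<Longrightarrow> t \<le> T \<Longrightarrow> norm (S t) \<le> m"
    and \<alpha>: "\<And>h. norm (\<alpha> h) \<le> a * (1 + norm h)" and a: "0 \<le> a"
    and \<sigma>: "\<And>h. (\<Sum>j. ennreal ((norm (\<sigma> h (g j)))\<^sup>2)) \<le> ennreal (b * (1 + norm h)\<^sup>2)" and b: "0 < b"
    and m: "0 < m" and R: "0 < R"
    and Z: "\<And>\<omega>. \<omega> \<in> space M \<Longrightarrow> continuous_on UNIV (\<lambda>s. Z s \<omega>)"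
      "(\<lambda>x. Z (fst x) (snd x)) \<in> borel_measurable (lborel \<Otimes>\<^sub>M M)"
      "AE \<omega> in M. \<forall>s\<in>{0..T}. Z s \<omega> = X s \<omega>"
    and t: "0 \<le> t" "t \<le> T"
  defines "Y \<equiv> \<lambda>t \<omega>. \<integral>\<^sup>+s\<in>{0..t}. ennreal ((1 + norm (Z s \<omega>))\<^sup>2) \<partial>lborel"
    and "C \<equiv> 3 * (T * (m * a)\<^sup>2) + 9 * (m\<^sup>2 * b)"
  shows "(\<integral>\<^sup>+\<omega>. ennreal ((norm (X t \<omega> - x))\<^sup>2) * indicator {\<omega>. Y t \<omega> \<le> ennreal R} \<omega> \<partial>M)
    \<le> ennreal (3 * (norm (S t x - x))\<^sup>2) + ennreal C * (\<integral>\<^sup>+\<omega>. min (ennreal R) (Y t \<omega>) \<partial>M)"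
proof -
  define \<Psi> where "\<Psi> s \<omega> u = S (t - s) (\<sigma> (X s \<omega>) u)" for s \<omega> u
  define D where "D \<omega> = (LINT s:{0..t}|lborel. S (t - s) (\<alpha> (X s \<omega>)))" for \<omega>
  define I where "I \<omega> = X t \<omega> - S t x - D \<omega>" for \<omega>
  define V where "V \<omega> = (\<integral>\<^sup>+s\<in>{0..t}. (\<Sum>j. ennreal ((norm (\<Psi> s \<omega> (g j)))\<^sup>2)) \<partial>lborel)" for \<omega>
  have "\<forall>t\<in>{0..T}. has_stoch_integral M F Q g W t (\<lambda>s \<omega> u. S (t - s) (\<sigma> (X s \<omega>) u))
        (\<lambda>\<omega>. X t \<omega> - S t x - (LINT s:{0..t}|lborel. S (t - s) (\<alpha> (X s \<omega>))))"
    using mild unfolding mild_solution_def by blast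
  from bspec[OF this, of t] have SI: "has_stoch_integral M F Q g W t \<Psi> I"
    using t unfolding \<Psi>_def[abs_def] I_def[abs_def] D_def[abs_def] by simp
  have Im[measurable]: "I \<in> borel_measurable M" using SI by (simp add: has_stoch_integral_def)
  have c: "0 < m\<^sup>2 * b" using m b by simp
  \<comment> \<open>\<open>V\<close> is at most m^2 b times \<open>Y t\<close>, so \<open>R\<close>
    as level for \<open>Y t\<close> corresponds to this level for \<open>V\<close>.\<close>
  then have Rc: "0 < m\<^sup>2 * b * R" using R by simp
  note bound = stochastic_integral_truncated_L2_bound[OF t SI Rc, folded V_def]
  have V_meas[measurable]: "V \<in> borel_measurable M"
    using bound(1) unfolding V_def[abs_def] .
  have Y_meas[measurable]: "Y t \<in> borel_measurable M"
  proof -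
    note Z(2)[measurable]
    have "(\<lambda>x. ennreal ((1 + norm (Z (fst x) (snd x)))\<^sup>2) * indicator {0..t} (fst x)) \<in> borel_measurable (lborel \<Otimes>\<^sub>M M)"
      by measurable
    from nn_integral_section_measurable[OF this] show ?thesis unfolding Y_def by simp
  qed
  have Y_mono: "Y t \<omega> \<le> ennreal R \<Longrightarrow> min (ennreal R) (Y t \<omega>) = Y t \<omega>" for \<omega> by (rule min_absorb2)
  have S_le: "norm (S (t - s) h) \<le> m * norm h" if "s \<in> {0..t}" for s h
  proof -
    have "norm (S (t - s) h) \<le> norm (S (t - s)) * norm h" by (rule norm_blinfun)
    also have "\<dots> \<le> m * norm h" using that t by (intro mult_right_mono S) auto
    finally show ?thesis .
  qed
  have VY: "V \<omega> \<le> ennreal (m\<^sup>2 * b) * Y t \<omega>" and DY: "ennreal ((norm (D \<omega>))\<^sup>2) \<le> ennreal (T * (m * a)\<^sup>2) * Y t \<omega>"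
    if eq: "\<forall>s\<in>{0..T}. Z s \<omega> = X s \<omega>" and \<omega>: "\<omega> \<in> space M" for \<omega>
  proof -
    have [measurable]: "(\<lambda>s. Z s \<omega>) \<in> borel_measurable borel"
      by (rule borel_measurable_continuous_onI[OF Z(1)[OF \<omega>]])
    have "V \<omega> \<le> (\<integral>\<^sup>+s. ennreal (m\<^sup>2 * b) * (ennreal ((1 + norm (Z s \<omega>))\<^sup>2) * indicator {0..t} s) \<partial>lborel)"
      unfolding V_def
    proof (rule nn_integral_mono)
      fix s
      show "(\<Sum>j. ennreal ((norm (\<Psi> s \<omega> (g j)))\<^sup>2)) * indicator {0..t} s \<le>
        ennreal (m\<^sup>2 * b) * (ennreal ((1 + norm (Z s \<omega>))\<^sup>2) * indicator {0..t} s)"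
      proof (cases "s \<in> {0..t}")
        case True
        have "(\<Sum>j. ennreal ((norm (\<Psi> s \<omega> (g j)))\<^sup>2)) \<le> (\<Sum>j. ennreal (m\<^sup>2) * ennreal ((norm (\<sigma> (X s \<omega>) (g j)))\<^sup>2))"
        proof (intro suminf_le allI)
          fix j
          have "(norm (\<Psi> s \<omega> (g j)))\<^sup>2 \<le> (m * norm (\<sigma> (X s \<omega>) (g j)))\<^sup>2"
            unfolding \<Psi>_def by (intro power_mono S_le[OF True]) simp
          then show "ennreal ((norm (\<Psi> s \<omega> (g j)))\<^sup>2) \<le> ennreal (m\<^sup>2) * ennreal ((norm (\<sigma> (X s \<omega>) (g j)))\<^sup>2)"
            by (subst ennreal_mult[symmetric]) (auto simp: power_mult_distrib intro: ennreal_leI)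
        qed (rule summableI)+
        also have "\<dots> = ennreal (m\<^sup>2) * (\<Sum>j. ennreal ((norm (\<sigma> (X s \<omega>) (g j)))\<^sup>2))" by (rule ennreal_suminf_cmult)
        also have "\<dots> \<le> ennreal (m\<^sup>2) * ennreal (b * (1 + norm (X s \<omega>))\<^sup>2)" by (intro mult_left_mono \<sigma>) simp
        also have "\<dots> = ennreal (m\<^sup>2 * b) * ennreal ((1 + norm (Z s \<omega>))\<^sup>2)"
          using eq True t b by (simp add: ennreal_mult mult.assoc)
        finally show ?thesis using True by simp
      qed simp
    qed
    also have "\<dots> = ennreal (m\<^sup>2 * b) * Y t \<omega>" unfolding Y_def by (intro nn_integral_cmult) measurable
    finally show "V \<omega> \<le> ennreal (m\<^sup>2 * b) * Y t \<omega>" .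
    have "ennreal ((norm (D \<omega>))\<^sup>2) \<le> ennreal (t * (m * a)\<^sup>2) * (\<integral>\<^sup>+s\<in>{0..t}. ennreal ((1 + norm (Z s \<omega>))\<^sup>2) \<partial>lborel)"
      unfolding D_def
    proof (rule drift_bound)
      fix s assume s: "s \<in> {0..t}"
      have "norm (S (t - s) (\<alpha> (X s \<omega>))) \<le> m * norm (\<alpha> (X s \<omega>))" by (rule S_le[OF s])
      also have "\<dots> \<le> m * (a * (1 + norm (X s \<omega>)))" using m \<alpha> by (intro mult_left_mono) auto
      finally show "norm (S (t - s) (\<alpha> (X s \<omega>))) \<le> (m * a) * (1 + norm (Z s \<omega>))" using eq s t by (simp add: mult.assoc)
    qed (use m a t in auto)
    also have "\<dots> \<le> ennreal (T * (m * a)\<^sup>2) * Y t \<omega>"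
      unfolding Y_def using t by (intro mult_right_mono ennreal_leI) auto
    finally show "ennreal ((norm (D \<omega>))\<^sup>2) \<le> ennreal (T * (m * a)\<^sup>2) * Y t \<omega>" .
  qed
  let ?p = "3 * (norm (S t x - x))\<^sup>2" and ?q = "3 * (T * (m * a)\<^sup>2)" and ?c = "m\<^sup>2 * b"
  let ?J = "\<lambda>\<omega>. ennreal ((norm (I \<omega>))\<^sup>2) * indicator {\<omega>. V \<omega> \<le> ennreal (?c * R)} \<omega>"
  have pt: "AE \<omega> in M. ennreal ((norm (X t \<omega> - x))\<^sup>2) * indicator {\<omega>. Y t \<omega> \<le> ennreal R} \<omega>
     \<le> ennreal ?p + ennreal ?q * min (ennreal R) (Y t \<omega>) + 3 * ?J \<omega>"
    using Z(3) AE_space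
  proof eventually_elim
    case (elim \<omega>)
    show ?case
    proof (cases "Y t \<omega> \<le> ennreal R")
      case True
      have "V \<omega> \<le> ennreal ?c * Y t \<omega>" by (rule VY) fact+
      also have "\<dots> \<le> ennreal ?c * ennreal R" by (intro mult_left_mono True) simp
      finally have VR: "V \<omega> \<le> ennreal (?c * R)" using c R by (simp add: ennreal_mult)
      have dec: "(S t x - x) + D \<omega> + I \<omega> = X t \<omega> - x" by (simp add: I_def)
      have "(norm (X t \<omega> - x))\<^sup>2 \<le> ?p + 3 * (norm (D \<omega>))\<^sup>2 + 3 * (norm (I \<omega>))\<^sup>2"
        using norm_add3_power2_le[of "S t x - x" "D \<omega>" "I \<omega>"] unfolding dec .
      then have "ennreal ((norm (X t \<omega> - x))\<^sup>2) \<le> ennreal (?p + 3 * (norm (D \<omega>))\<^sup>2 + 3 * (norm (I \<omega>))\<^sup>2)"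
        by (rule ennreal_leI)
      also have "\<dots> = ennreal ?p + 3 * ennreal ((norm (D \<omega>))\<^sup>2) + 3 * ennreal ((norm (I \<omega>))\<^sup>2)"
        by (simp add: ennreal_mult)
      also have "\<dots> \<le> ennreal ?p + 3 * (ennreal (T * (m * a)\<^sup>2) * Y t \<omega>) + 3 * ennreal ((norm (I \<omega>))\<^sup>2)"
        by (intro add_mono mult_left_mono DY order_refl) (use elim in auto)
      also have "3 * (ennreal (T * (m * a)\<^sup>2) * Y t \<omega>) = ennreal ?q * min (ennreal R) (Y t \<omega>)"
        using t Y_mono[OF True] by (simp add: ennreal_mult mult.assoc)
      finally show ?thesis using True VR by simp
    qed simp
  qed
  have VYmin: "AE \<omega> in M. min (ennreal (?c * R)) (V \<omega>) \<le> ennreal ?c * min (ennreal R) (Y t \<omega>)"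
    using Z(3) AE_space
  proof eventually_elim
    case (elim \<omega>)
    then show ?case using c R by (intro min_mult_le_ennreal VY) auto
  qed
  have "(\<integral>\<^sup>+\<omega>. ennreal ((norm (X t \<omega> - x))\<^sup>2) * indicator {\<omega>. Y t \<omega> \<le> ennreal R} \<omega> \<partial>M)
    \<le> (\<integral>\<^sup>+\<omega>. ennreal ?p + ennreal ?q * min (ennreal R) (Y t \<omega>) + 3 * ?J \<omega> \<partial>M)"
    by (rule nn_integral_mono_AE[OF pt])
  also have "\<dots> = ennreal ?p + ennreal ?q * (\<integral>\<^sup>+\<omega>. min (ennreal R) (Y t \<omega>) \<partial>M) + 3 * (\<integral>\<^sup>+\<omega>. ?J \<omega> \<partial>M)"
    by (simp add: nn_integral_add nn_integral_cmult emeasure_space_1)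
  also have "(\<integral>\<^sup>+\<omega>. ?J \<omega> \<partial>M) \<le> 3 * (\<integral>\<^sup>+\<omega>. min (ennreal (?c * R)) (V \<omega>) \<partial>M)"
    using bound(2) unfolding V_def .
  also have "(\<integral>\<^sup>+\<omega>. min (ennreal (?c * R)) (V \<omega>) \<partial>M) \<le> (\<integral>\<^sup>+\<omega>. ennreal ?c * min (ennreal R) (Y t \<omega>) \<partial>M)"
    by (rule nn_integral_mono_AE[OF VYmin])
  also have "\<dots> = ennreal ?c * (\<integral>\<^sup>+\<omega>. min (ennreal R) (Y t \<omega>) \<partial>M)"
    by (intro nn_integral_cmult) measurable
  finally have "(\<integral>\<^sup>+\<omega>. ennreal ((norm (X t \<omega> - x))\<^sup>2) * indicator {\<omega>. Y t \<omega> \<le> ennreal R} \<omega> \<partial>M) \<le>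
    ennreal ?p + ennreal ?q * (\<integral>\<^sup>+\<omega>. min (ennreal R) (Y t \<omega>) \<partial>M)
    + 3 * (3 * (ennreal ?c * (\<integral>\<^sup>+\<omega>. min (ennreal R) (Y t \<omega>) \<partial>M)))"
    by (simp add: mult_left_mono add_left_mono)
  also have "\<dots> = ennreal ?p + ennreal C * (\<integral>\<^sup>+\<omega>. min (ennreal R) (Y t \<omega>) \<partial>M)"
  proof -
    \<comment> \<open>Both summands carry a factor 3 from splitting a square into three terms; the
      stochastic one carries another 3 from the truncated isometry.\<close>
    have "ennreal C = ennreal ?q + ennreal (9 * ?c)"
      unfolding C_def using t c by (intro ennreal_plus) auto
    also have "ennreal (9 * ?c) = 9 * ennreal ?c" using c by (subst ennreal_mult) auto
    also have "\<dots> = 3 * (3 * ennreal ?c)" by (simp add: mult.assoc[symmetric])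
    finally have "ennreal C = ennreal ?q + 3 * (3 * ennreal ?c)" .
    then show ?thesis by (simp only: distrib_right mult.assoc add.assoc)
  qed
  finally show ?thesis .
qed

text \<open>The constant \<open>A\<close> arises from bounding
  \<open>(1 + norm (X s \<omega>))\<^sup>2\<close> by \<open>2 * (1 + norm x)\<^sup>2\<close> plus
  twice the squared displacement, and from \<open>norm (S s x - x) \<le> (m + 1) * norm x\<close>.
  This crude bound serves at the intermediate times only; at the final time
  \<open>norm (S t x - x)\<close> is kept, since it has to become small.\<close>

lemma mild_solution_displacement:
  fixes S :: "real \<Rightarrow> 'h::{real_inner,complete_space,second_countable_topology} \<Rightarrow>\<^sub>L 'h"
  assumes mild: "mild_solution M T F Q g W S \<alpha> \<sigma> x X"
    and S: "\<And>t. 0 \<le> t \<Longrightarrow> t \<le> T \<Longrightarrow> norm (S t) \<le> m"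
    and \<alpha>: "\<And>h. norm (\<alpha> h) \<le> a * (1 + norm h)" and a: "0 \<le> a"
    and \<sigma>: "\<And>h. (\<Sum>j. ennreal ((norm (\<sigma> h (g j)))\<^sup>2)) \<le> ennreal (b * (1 + norm h)\<^sup>2)" and b: "0 < b"
    and m: "0 < m" and t: "0 \<le> t" "t \<le> T"
  defines "C \<equiv> 3 * (T * (m * a)\<^sup>2) + 9 * (m\<^sup>2 * b)" and "A \<equiv> 2 * (1 + norm x)\<^sup>2 + 6 * ((m + 1) * norm x)\<^sup>2"
  assumes small: "4 * C * t \<le> 1"
  shows "(\<integral>\<^sup>+\<omega>. ennreal ((norm (X t \<omega> - x))\<^sup>2) \<partial>M) \<le> ennreal (3 * (norm (S t x - x))\<^sup>2 + 2 * A * C * t)"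
proof -
  have C: "0 < C" unfolding C_def using t a m b by (intro add_nonneg_pos) auto
  have A: "0 \<le> A" by (simp add: A_def)
  have Xm: "X s \<in> borel_measurable M" if "0 \<le> s" "s \<le> T" for s
    using mild that measurable_from_subalg[OF F_subalgebra[OF that], of "X s" borel]
    by (simp add: mild_solution_def)
  obtain Z where Z: "\<And>\<omega>. \<omega> \<in> space M \<Longrightarrow> continuous_on UNIV (\<lambda>s. Z s \<omega>)"
      "(\<lambda>x. Z (fst x) (snd x)) \<in> borel_measurable (lborel \<Otimes>\<^sub>M M)"
      "AE \<omega> in M. \<forall>s\<in>{0..T}. Z s \<omega> = X s \<omega>"
  proof (rule continuous_modification[of T X M])
    show "0 \<le> T" using t by simp
    show "AE \<omega> in M. continuous_on {0..T} (\<lambda>t. X t \<omega>)" using mild by (simp add: mild_solution_def)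
  qed (use Xm in auto)
  define c where "c s \<omega> = (1 + norm (Z s \<omega>))\<^sup>2" for s \<omega>
  define Y where "Y t \<omega> = (\<integral>\<^sup>+s\<in>{0..t}. ennreal (c s \<omega>) \<partial>lborel)" for t \<omega>
  have c_cont: "continuous_on UNIV (\<lambda>s. c s \<omega>)" if "\<omega> \<in> space M" for \<omega>
    unfolding c_def by (intro continuous_intros Z(1) that)
  have c_nonneg: "0 \<le> c s \<omega>" for s \<omega> by (simp add: c_def)
  have Y_mono: "Y s \<omega> \<le> Y r \<omega>" if "s \<le> r" for s r \<omega>
    unfolding Y_def using that by (intro nn_integral_mono) (auto split: split_indicator)
  have cm[measurable]: "(\<lambda>x. c (fst x) (snd x)) \<in> borel_measurable (lborel \<Otimes>\<^sub>M M)"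
    unfolding c_def using Z(2) by measurable
  \<comment> \<open>The upper limit of the time integral is itself a variable, so the cut-off
    integrand is taken on the product of time with time and outcomes, and one time variable is
    integrated out.\<close>
  have Yj[measurable]: "(\<lambda>x. Y (fst x) (snd x)) \<in> borel_measurable (lborel \<Otimes>\<^sub>M M)"
  proof -
    have "(\<lambda>z. (fst z, snd (snd z))) \<in> measurable (lborel \<Otimes>\<^sub>M (lborel \<Otimes>\<^sub>M M)) (lborel \<Otimes>\<^sub>M M)"
      by measurable
    from measurable_compose[OF this cm]
    have [measurable]: "(\<lambda>z. c (fst z) (snd (snd z))) \<in> borel_measurable (lborel \<Otimes>\<^sub>M (lborel \<Otimes>\<^sub>M M))"
      by simp
    have "(\<lambda>z. if 0 \<le> fst z \<and> fst z \<le> fst (snd z) then ennreal (c (fst z) (snd (snd z))) else 0)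
      \<in> borel_measurable (lborel \<Otimes>\<^sub>M (lborel \<Otimes>\<^sub>M M))"
      by measurable
    from nn_integral_section_measurable[OF this]
    have "(\<lambda>x. \<integral>\<^sup>+s. (if 0 \<le> s \<and> s \<le> fst x then ennreal (c s (snd x)) else 0) \<partial>lborel) \<in> borel_measurable (lborel \<Otimes>\<^sub>M M)"
      by (simp only: fst_conv snd_conv)
    moreover have "Y (fst x) (snd x) = (\<integral>\<^sup>+s. (if 0 \<le> s \<and> s \<le> fst x then ennreal (c s (snd x)) else 0) \<partial>lborel)" for x
      unfolding Y_def by (intro nn_integral_cong) (auto split: split_indicator)
    ultimately show ?thesis by (simp only:)
  qed
  have sec: "(\<lambda>\<omega>. f (s, \<omega>)) \<in> borel_measurable M" if "f \<in> borel_measurable (lborel \<Otimes>\<^sub>M M)" for f :: "real \<times> 'w \<Rightarrow> 'b::topological_space" and s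
    using measurable_Pair2[OF that, of s] by simp
  have Ys[measurable]: "Y s \<in> borel_measurable M" for s using sec[OF Yj, of s] by simp
  define u where "u R s = (\<integral>\<^sup>+\<omega>. min (ennreal R) (Y s \<omega>) \<partial>M)" for R s
  define G where "G R s = (\<integral>\<^sup>+\<omega>. ennreal ((norm (X s \<omega> - x))\<^sup>2) * indicator {\<omega>. Y s \<omega> \<le> ennreal R} \<omega> \<partial>M)" for R s
  have G: "G R s \<le> ennreal (3 * (norm (S s x - x))\<^sup>2) + ennreal C * u R s" if "0 < R" "0 \<le> s" "s \<le> T" for R s
    using mild_solution_truncated_displacement[OF mild S \<alpha> a \<sigma> b m that(1) Z that(2,3)]
    unfolding G_def u_def Y_def c_def C_def by simp
  have f: "(\<integral>\<^sup>+\<omega>. ennreal (c s \<omega>) * indicator {\<omega>. Y s \<omega> \<le> ennreal R} \<omega> \<partial>M) \<le> ennreal A + ennreal (2 * C) * u R s"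
    if R: "0 < R" and s: "0 \<le> s" "s \<le> T" for R s
  proof -
    note [measurable] = Xm[OF s]
    have pt: "AE \<omega> in M. ennreal (c s \<omega>) * indicator {\<omega>. Y s \<omega> \<le> ennreal R} \<omega> \<le>
      ennreal (2 * (1 + norm x)\<^sup>2) + 2 * (ennreal ((norm (X s \<omega> - x))\<^sup>2) * indicator {\<omega>. Y s \<omega> \<le> ennreal R} \<omega>)"
      using Z(3)
    proof eventually_elim
      case (elim \<omega>)
      have "norm (X s \<omega>) \<le> norm x + norm (X s \<omega> - x)" using norm_triangle_ineq[of x "X s \<omega> - x"] by simp
      then have "(1 + norm (X s \<omega>))\<^sup>2 \<le> ((1 + norm x) + norm (X s \<omega> - x))\<^sup>2" by (intro power_mono) auto
      also have "\<dots> \<le> 2 * (1 + norm x)\<^sup>2 + 2 * (norm (X s \<omega> - x))\<^sup>2"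
        using norm_add_power2_le[of "1 + norm x" "norm (X s \<omega> - x)"] by simp
      finally have "ennreal (c s \<omega>) \<le> ennreal (2 * (1 + norm x)\<^sup>2 + 2 * (norm (X s \<omega> - x))\<^sup>2)"
        using elim s by (intro ennreal_leI) (simp add: c_def)
      then have "ennreal (c s \<omega>) \<le> ennreal (2 * (1 + norm x)\<^sup>2) + 2 * ennreal ((norm (X s \<omega> - x))\<^sup>2)"
        by (simp add: ennreal_mult)
      then show ?case by (simp split: split_indicator)
    qed
    have "(\<integral>\<^sup>+\<omega>. ennreal (c s \<omega>) * indicator {\<omega>. Y s \<omega> \<le> ennreal R} \<omega> \<partial>M) \<le>
      (\<integral>\<^sup>+\<omega>. ennreal (2 * (1 + norm x)\<^sup>2) + 2 * (ennreal ((norm (X s \<omega> - x))\<^sup>2) * indicator {\<omega>. Y s \<omega> \<le> ennreal R} \<omega>) \<partial>M)"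
      by (rule nn_integral_mono_AE[OF pt])
    also have "\<dots> = ennreal (2 * (1 + norm x)\<^sup>2) + 2 * G R s"
      unfolding G_def by (simp add: nn_integral_add nn_integral_cmult emeasure_space_1)
    also have "\<dots> \<le> ennreal (2 * (1 + norm x)\<^sup>2) + 2 * (ennreal (3 * ((m + 1) * norm x)\<^sup>2) + ennreal C * u R s)"
    proof (intro add_left_mono mult_left_mono order_trans[OF G[OF R s]] add_right_mono ennreal_leI power_mono)
      have "norm (S s x - x) \<le> norm (S s) * norm x + norm x"
        using norm_triangle_ineq4[of "S s x" x] norm_blinfun[of "S s" x] by simp
      also have "\<dots> \<le> m * norm x + norm x" by (intro add_right_mono mult_right_mono S s) simp
      finally show "norm (S s x - x) \<le> (m + 1) * norm x" by (simp add: distrib_right)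
    qed auto
    also have "\<dots> = ennreal A + ennreal (2 * C) * u R s"
    proof -
      have "ennreal A = ennreal (2 * (1 + norm x)\<^sup>2) + ennreal (2 * (3 * ((m + 1) * norm x)\<^sup>2))"
        unfolding A_def by (subst ennreal_plus[symmetric]) auto
      also have "ennreal (2 * (3 * ((m + 1) * norm x)\<^sup>2)) = 2 * ennreal (3 * ((m + 1) * norm x)\<^sup>2)"
        by (subst ennreal_mult) auto
      finally have "ennreal A = ennreal (2 * (1 + norm x)\<^sup>2) + 2 * ennreal (3 * ((m + 1) * norm x)\<^sup>2)" .
      moreover have "ennreal (2 * C) = 2 * ennreal C" using C by (subst ennreal_mult) auto
      ultimately show ?thesis by (simp only: distrib_left mult.assoc add.assoc)
    qed
    finally show ?thesis .
  qed
  have u_bound: "u R t \<le> ennreal (2 * A * t)" if R: "0 < R" for R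
  proof -
    interpret pair_sigma_finite lborel M by unfold_locales
    let ?f = "\<lambda>s \<omega>. ennreal (c s \<omega>) * indicator {s. Y s \<omega> \<le> ennreal R} s * indicator {0..t} s"
    have fm: "case_prod ?f \<in> borel_measurable (lborel \<Otimes>\<^sub>M M)"
    proof -
      have "(\<lambda>x. (if Y (fst x) (snd x) \<le> ennreal R \<and> 0 \<le> fst x \<and> fst x \<le> t then ennreal (c (fst x) (snd x)) else 0)) \<in> borel_measurable (lborel \<Otimes>\<^sub>M M)"
        by measurable
      also have "(\<lambda>x. (if Y (fst x) (snd x) \<le> ennreal R \<and> 0 \<le> fst x \<and> fst x \<le> t then ennreal (c (fst x) (snd x)) else 0)) = case_prod ?f"
        by (auto simp: fun_eq_iff split: split_indicator)
      finally show ?thesis .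
    qed
    \<comment> \<open>The pathwise comparison comes before Fubini, so that the bound
      \<open>f\<close> can be applied at each fixed time; monotonicity then replaces
      \<open>u R s\<close> by \<open>u R t\<close>.\<close>
    have "u R t \<le> (\<integral>\<^sup>+\<omega>. (\<integral>\<^sup>+s. ?f s \<omega> \<partial>lborel) \<partial>M)"
      unfolding u_def
    proof (rule nn_integral_mono)
      fix \<omega> assume "\<omega> \<in> space M"
      from min_primitive_le[OF c_cont[OF this] c_nonneg, of R t] R t
      show "min (ennreal R) (Y t \<omega>) \<le> (\<integral>\<^sup>+s. ?f s \<omega> \<partial>lborel)" unfolding Y_def by simp
    qed
    also have "\<dots> = (\<integral>\<^sup>+s. (\<integral>\<^sup>+\<omega>. ?f s \<omega> \<partial>M) \<partial>lborel)" by (rule Fubini'[OF fm])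
    also have "\<dots> \<le> (\<integral>\<^sup>+s. (ennreal A + ennreal (2 * C) * u R t) * indicator {0..t} s \<partial>lborel)"
    proof (rule nn_integral_mono)
      fix s
      show "(\<integral>\<^sup>+\<omega>. ?f s \<omega> \<partial>M) \<le> (ennreal A + ennreal (2 * C) * u R t) * indicator {0..t} s"
      proof (cases "s \<in> {0..t}")
        case True
        then have "(\<integral>\<^sup>+\<omega>. ?f s \<omega> \<partial>M) = (\<integral>\<^sup>+\<omega>. ennreal (c s \<omega>) * indicator {\<omega>. Y s \<omega> \<le> ennreal R} \<omega> \<partial>M)"
          by (intro nn_integral_cong) (simp split: split_indicator)
        also have "\<dots> \<le> ennreal A + ennreal (2 * C) * u R s" using f R True t by simp
        also have "u R s \<le> u R t" unfolding u_def using True by (intro nn_integral_mono min.mono Y_mono) auto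
        finally show ?thesis using True by (simp add: add_left_mono mult_left_mono)
      qed simp
    qed
    also have "\<dots> = (ennreal A + ennreal (2 * C) * u R t) * ennreal t"
      using t by (subst nn_integral_cmult_indicator) auto
    finally have u_le: "u R t \<le> (ennreal A + ennreal (2 * C) * u R t) * ennreal t" .
    \<comment> \<open>Truncation makes \<open>u R t\<close> finite, so the inequality can be
      rearranged among real numbers.\<close>
    have "u R t \<le> (\<integral>\<^sup>+\<omega>. ennreal R \<partial>M)" unfolding u_def by (intro nn_integral_mono) simp
    also have "\<dots> < \<infinity>" by (simp add: emeasure_space_1)
    finally obtain v where v: "u R t = ennreal v" "0 \<le> v" by (cases "u R t") auto
    have "(ennreal A + ennreal (2 * C) * u R t) * ennreal t = ennreal ((A + 2 * C * v) * t)"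
      unfolding v(1) using A C v t by (simp add: ennreal_mult'' ennreal_plus mult.assoc)
    with u_le v have "v \<le> (A + 2 * C * v) * t" using A C t by (simp add: ennreal_le_iff)
    \<comment> \<open>Smallness of \<open>t\<close> makes the recurring term at most
      \<open>v / 2\<close>, whence \<open>v / 2 \<le> A * t\<close>.\<close>
    moreover have "4 * C * t * v \<le> 1 * v" by (intro mult_right_mono small v)
    ultimately have "v \<le> 2 * A * t" by (simp add: algebra_simps)
    then show ?thesis unfolding v(1) by (rule ennreal_leI)
  qed
  let ?B = "ennreal (3 * (norm (S t x - x))\<^sup>2 + 2 * A * C * t)"
  have G_bound: "G R t \<le> ?B" if "0 < R" for R
  proof -
    have "G R t \<le> ennreal (3 * (norm (S t x - x))\<^sup>2) + ennreal C * ennreal (2 * A * t)"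
      using G[OF that t] by (rule order_trans) (intro add_left_mono mult_left_mono u_bound that, simp)
    also have "\<dots> = ?B"
      using A C t by (simp add: ennreal_mult[symmetric] ennreal_plus[symmetric] mult_ac del: ennreal_plus)
    finally show ?thesis .
  qed
  note [measurable] = Xm[OF t]
  \<comment> \<open>Every path of \<open>Z\<close> is continuous, so \<open>Y t \<omega>\<close> is
    finite and the indicator is eventually 1 for each outcome. \<open>Suc n\<close> keeps the level
    positive, as \<open>G_bound\<close> requires.\<close>
  let ?h = "\<lambda>n \<omega>. ennreal ((norm (X t \<omega> - x))\<^sup>2) * indicator {\<omega>. Y t \<omega> \<le> ennreal (real (Suc n))} \<omega>"
  have "(\<integral>\<^sup>+\<omega>. ennreal ((norm (X t \<omega> - x))\<^sup>2) \<partial>M) = (\<integral>\<^sup>+\<omega>. liminf (\<lambda>n. ?h n \<omega>) \<partial>M)"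
  proof (rule nn_integral_cong)
    fix \<omega> assume \<omega>: "\<omega> \<in> space M"
    have "Y t \<omega> = ennreal (integral {0..t} (\<lambda>s. c s \<omega>))"
      unfolding Y_def by (intro nn_integral_Icc_eq_integral c_nonneg continuous_on_subset[OF c_cont[OF \<omega>]]) simp
    moreover obtain n0 :: nat where "integral {0..t} (\<lambda>s. c s \<omega>) \<le> real n0"
      using real_arch_simple by blast
    ultimately have "Y t \<omega> \<le> ennreal (real (Suc n))" if "n \<ge> n0" for n
      using that by (simp add: ennreal_leI del: of_nat_Suc)
    then have "eventually (\<lambda>n. ?h n \<omega> = ennreal ((norm (X t \<omega> - x))\<^sup>2)) sequentially"
      by (intro eventually_sequentiallyI[of n0]) (simp del: of_nat_Suc)
    then have "(\<lambda>n. ?h n \<omega>) \<longlonglongrightarrow> ennreal ((norm (X t \<omega> - x))\<^sup>2)" by (rule tendsto_eventually)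
    then show "ennreal ((norm (X t \<omega> - x))\<^sup>2) = liminf (\<lambda>n. ?h n \<omega>)"
      by (intro lim_imp_Liminf[symmetric]) auto
  qed
  also have "\<dots> \<le> liminf (\<lambda>n. \<integral>\<^sup>+\<omega>. ?h n \<omega> \<partial>M)"
    by (rule nn_integral_liminf) measurable
  also have "\<dots> \<le> limsup (\<lambda>n. \<integral>\<^sup>+\<omega>. ?h n \<omega> \<partial>M)" by (rule Liminf_le_Limsup) simp
  also have "\<dots> \<le> ?B"
  proof (rule Limsup_bounded, intro always_eventually allI)
    fix n
    show "(\<integral>\<^sup>+\<omega>. ?h n \<omega> \<partial>M) \<le> ?B" using G_bound[of "real (Suc n)"] unfolding G_def by simp
  qed
  finally show ?thesis .
qed

end

text \<open>Comparison with the value at 0 through the Lipschitz bound in the Hilbert-Schmidt norm.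
  The result is phrased with \<open>ennreal\<close> series to fit the time integrals above.\<close>

lemma L20_linear_growth:
  fixes \<sigma> :: "'h::real_normed_vector \<Rightarrow> 'u::real_inner \<Rightarrow> 'b::real_normed_vector"
  assumes L20: "\<And>h. \<sigma> h \<in> L20 Q g"
    and Lip: "\<And>h k. L20_norm g (\<lambda>u. \<sigma> h u - \<sigma> k u) \<le> L * dist h k"
  obtains b where "0 < b" "\<And>h. (\<Sum>j. ennreal ((norm (\<sigma> h (g j)))\<^sup>2)) \<le> ennreal (b * (1 + norm h)\<^sup>2)"
proof -
  define s0 where "s0 = (\<Sum>j. (norm (\<sigma> 0 (g j)))\<^sup>2)"
  have summ: "summable (\<lambda>j. (norm (\<sigma> h (g j)))\<^sup>2)" for h
    using L20[of h] unfolding L20_def by blast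
  have s0: "0 \<le> s0" unfolding s0_def by (intro suminf_nonneg summ) simp
  \<comment> \<open>The summand 1 makes \<open>b\<close> strictly positive, so that the truncation
    level for \<open>V\<close> is positive too.\<close>
  define b where "b = 2 * s0 + 2 * L\<^sup>2 + 1"
  have b: "0 < b" using s0 by (simp add: b_def add_nonneg_pos)
  moreover have "(\<Sum>j. ennreal ((norm (\<sigma> h (g j)))\<^sup>2)) \<le> ennreal (b * (1 + norm h)\<^sup>2)" for h
  proof -
    let ?d = "\<lambda>j. (norm (\<sigma> h (g j) - \<sigma> 0 (g j)))\<^sup>2"
    have le: "?d j \<le> 2 * (norm (\<sigma> h (g j)))\<^sup>2 + 2 * (norm (\<sigma> 0 (g j)))\<^sup>2" for j
      using norm_add_power2_le[of "\<sigma> h (g j)" "- \<sigma> 0 (g j)"] by simp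
    \<comment> \<open>\<open>L20_norm\<close> is built on \<open>suminf\<close>, which says nothing
      about a divergent series; the Lipschitz bound becomes usable once the differences are known to
      be summable.\<close>
    have sd: "summable ?d"
      by (rule summable_comparison_test'[OF summable_add[OF summable_mult[OF summ[of h]] summable_mult[OF summ[of 0]]], of 0 _ 2 2])
        (use le in auto)
    have "sqrt (\<Sum>j. ?d j) \<le> L * norm h" using Lip[of h 0] by (simp add: L20_norm_def)
    then have "(sqrt (\<Sum>j. ?d j))\<^sup>2 \<le> (L * norm h)\<^sup>2" by (intro power_mono) (auto intro: suminf_nonneg sd)
    then have d: "(\<Sum>j. ?d j) \<le> L\<^sup>2 * (norm h)\<^sup>2" using suminf_nonneg[OF sd] by (simp add: power_mult_distrib)
    have le2: "(norm (\<sigma> h (g j)))\<^sup>2 \<le> 2 * (norm (\<sigma> 0 (g j)))\<^sup>2 + 2 * ?d j" for j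
      using norm_add_power2_le[of "\<sigma> 0 (g j)" "\<sigma> h (g j) - \<sigma> 0 (g j)"] by simp
    have "(\<Sum>j. (norm (\<sigma> h (g j)))\<^sup>2) \<le> (\<Sum>j. 2 * (norm (\<sigma> 0 (g j)))\<^sup>2 + 2 * ?d j)"
      by (intro suminf_le le2 summ summable_add summable_mult sd)
    also have "\<dots> = 2 * s0 + 2 * (\<Sum>j. ?d j)"
      unfolding s0_def by (simp only: suminf_add[symmetric, OF summable_mult[OF summ] summable_mult[OF sd]] suminf_mult[OF summ] suminf_mult[OF sd])
    also have "\<dots> \<le> 2 * s0 * 1 + 2 * L\<^sup>2 * (norm h)\<^sup>2" using d by simp
    also have "\<dots> \<le> 2 * s0 * (1 + norm h)\<^sup>2 + 2 * L\<^sup>2 * (1 + norm h)\<^sup>2"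
      using s0 by (intro add_mono mult_left_mono power_mono one_le_power) auto
    also have "\<dots> \<le> b * (1 + norm h)\<^sup>2" by (simp add: b_def algebra_simps)
    finally have "(\<Sum>j. (norm (\<sigma> h (g j)))\<^sup>2) \<le> b * (1 + norm h)\<^sup>2" .
    moreover have "(\<Sum>j. ennreal ((norm (\<sigma> h (g j)))\<^sup>2)) = ennreal (\<Sum>j. (norm (\<sigma> h (g j)))\<^sup>2)"
      by (rule suminf_ennreal2[OF _ summ]) simp
    ultimately show ?thesis by (simp only: ennreal_leI)
  qed
  ultimately show ?thesis using that by blast
qed

section \<open>Choice of the neighbourhood and the time horizon\<close>

theorem corollary4p7:
  fixes M :: "'w measure"
    and T :: real
    and F :: "real \<Rightarrow> 'w measure"
    and A :: "'h::{real_inner,complete_space,second_countable_topology} \<Rightarrow> 'h"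
    and domA :: "'h set"
    and S :: "real \<Rightarrow> 'h \<Rightarrow>\<^sub>L 'h"
    and \<beta> :: real
    and Q :: "'u::{real_inner,complete_space,second_countable_topology} \<Rightarrow>\<^sub>L 'u"
    and e :: "nat \<Rightarrow> 'u"
    and ev :: "nat \<Rightarrow> real"
    and g :: "nat \<Rightarrow> 'u"
    and W :: "real \<Rightarrow> 'w \<Rightarrow> 'u"
    and \<alpha> :: "'h \<Rightarrow> 'h"
    and \<sigma> :: "'h \<Rightarrow> 'u \<Rightarrow> 'h"
    and \<rho> :: "'h \<Rightarrow> 'h"
    and X :: "'h \<Rightarrow> real \<Rightarrow> 'w \<Rightarrow> 'h"
    and K :: "'h set"
    and \<epsilon> :: real
  assumes "T > 0"
    and "usual_filtration M T F"
    and "C0_semigroup S"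
    and "is_generator S domA A"
    and "\<beta> \<ge> 0"
    and "\<And>t. t \<ge> 0 \<Longrightarrow> norm (S t) \<le> exp (\<beta> * t)"
    and "nuclear Q"
    and "self_adjoint Q"
    and "positive_definite Q"
    and "orthonormal_basis e"
    and "\<And>j. ev j > 0"
    and "summable ev"
    and "\<And>j. Q (e j) = ev j *\<^sub>R e j"
    and "\<And>j. g j = sqrt (ev j) *\<^sub>R e j"
    and "Q_Wiener M T F Q W"
    and "\<exists>L. L-lipschitz_on UNIV \<alpha>"
    and "\<And>h. \<sigma> h \<in> L20 Q g"
    and "\<exists>L. \<forall>h k. L20_norm g (\<lambda>u. \<sigma> h u - \<sigma> k u) \<le> L * dist h k"
    and "\<And>j. Cb2 (\<lambda>h. \<sigma> h (g j))"
    and "summable (\<lambda>j. L_const (\<lambda>h. \<sigma> h (g j)))"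
    and "\<And>h. (\<lambda>r. (1 / 2) *\<^sub>R (\<Sum>j<r. Dop (\<lambda>h. \<sigma> h (g j)) h (\<sigma> h (g j)))) \<longlonglongrightarrow> \<rho> h"
    and "\<And>x. mild_solution M T F Q g W S \<alpha> \<sigma> x (X x)"
    and "K \<noteq> {}"
    and "closed K"
    and "\<epsilon> > 0"
    and "\<And>h u. h \<in> K \<Longrightarrow> u \<in> U0 Q \<Longrightarrow>
           Liminf (at_right 0)
             (\<lambda>t. ereal (1 / t * infdist (S t h + t *\<^sub>R (\<alpha> h - \<rho> h + \<sigma> h u)) K)) \<le> ereal \<epsilon>"
  shows "\<forall>x0. \<forall>\<delta>>0. \<exists>S0\<in>{0<..T}. \<exists>V. open V \<and> x0 \<in> V \<and>
           (\<forall>t\<in>{0..S0}. \<forall>x\<in>K \<inter> V.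
              integrable M (\<lambda>\<omega>. (infdist (X x t \<omega>) K)\<^sup>2) \<and>
              sqrt (\<integral>\<omega>. (infdist (X x t \<omega>) K)\<^sup>2 \<partial>M) \<le> \<delta>)"
proof (intro allI impI)
  fix x0 :: 'h and \<delta> :: real
  assume \<delta>: "\<delta> > 0"
  interpret wiener_integral M T F Q e ev g W
    by unfold_locales (fact+)
  define m where "m = exp (\<beta> * T)"
  have m: "0 < m" by (simp add: m_def)
  have S_le: "norm (S t) \<le> m" if "0 \<le> t" "t \<le> T" for t
    using assms(6)[OF that(1)] mult_left_mono[OF that(2) \<open>\<beta> \<ge> 0\<close>] by (simp add: m_def order_trans)
  obtain L where L: "L-lipschitz_on UNIV \<alpha>" using assms(16) by blast
  define a where "a = norm (\<alpha> 0) + L"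
  have L0: "0 \<le> L" using L by (rule lipschitz_on_nonneg)
  have a: "0 \<le> a" using L0 by (simp add: a_def)
  have \<alpha>_le: "norm (\<alpha> h) \<le> a * (1 + norm h)" for h
  proof -
    have "norm (\<alpha> h) \<le> norm (\<alpha> 0) + norm (\<alpha> h - \<alpha> 0)" using norm_triangle_ineq[of "\<alpha> 0" "\<alpha> h - \<alpha> 0"] by simp
    also have "norm (\<alpha> h - \<alpha> 0) \<le> L * norm h" using lipschitz_onD[OF L, of h 0] by (simp add: dist_norm)
    also have "norm (\<alpha> 0) + L * norm h \<le> a * (1 + norm h)"
      using L0 mult_nonneg_nonneg[OF norm_ge_zero norm_ge_zero, of "\<alpha> 0" h] by (simp add: a_def algebra_simps)
    finally show ?thesis by simp
  qed
  obtain L' where "\<forall>h k. L20_norm g (\<lambda>u. \<sigma> h u - \<sigma> k u) \<le> L' * dist h k" using assms(18) by blast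
  then have L': "\<And>h k. L20_norm g (\<lambda>u. \<sigma> h u - \<sigma> k u) \<le> L' * dist h k" by blast
  obtain b where b: "0 < b" "\<And>h. (\<Sum>j. ennreal ((norm (\<sigma> h (g j)))\<^sup>2)) \<le> ennreal (b * (1 + norm h)\<^sup>2)"
    by (rule L20_linear_growth[OF assms(17) L']) blast
  define C where "C = 3 * (T * (m * a)\<^sup>2) + 9 * (m\<^sup>2 * b)"
  have C: "0 < C" unfolding C_def using \<open>T > 0\<close> a m b by (intro add_nonneg_pos) auto
  \<comment> \<open>This dominates the initial-value constant of
    \<open>mild_solution_displacement\<close> for all \<open>x\<close> within distance 1 of
    \<open>x0\<close>; hence the cap at 1 in \<open>r\<close>.\<close>
  define A where "A = 2 * (1 + (norm x0 + 1))\<^sup>2 + 6 * ((m + 1) * (norm x0 + 1))\<^sup>2"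
  have A: "0 < A" unfolding A_def by (intro add_pos_nonneg) (auto simp: add_nonneg_eq_0_iff)
  define r where "r = min 1 (\<delta> / (4 * (m + 1)))"
  have r: "0 < r" "r \<le> 1" using \<delta> m by (auto simp: r_def)
  have "(m + 1) * r \<le> (m + 1) * (\<delta> / (4 * (m + 1)))" using m by (intro mult_left_mono) (auto simp: r_def)
  also have "\<dots> = \<delta> / 4" using m by (simp add: divide_simps)
  finally have mr: "(m + 1) * r \<le> \<delta> / 4" .
  have "((\<lambda>t. S t x0) \<longlongrightarrow> x0) (at_right 0)" and S0: "S 0 = id_blinfun"
    using assms(3) by (auto simp: C0_semigroup_def)
  from this(1) \<delta> have "eventually (\<lambda>t. dist (S t x0) x0 < \<delta> / 4) (at_right 0)" by (intro tendstoD) auto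
  then obtain d where d: "0 < d" "\<And>t. 0 < t \<Longrightarrow> t < d \<Longrightarrow> dist (S t x0) x0 < \<delta> / 4"
    unfolding eventually_at_right_field by blast
  \<comment> \<open>\<open>d / 2\<close> keeps times strictly below \<open>d\<close>,
    \<open>1 / (4 * C)\<close> is the smallness needed for absorption, and the last entry gives
    \<open>2 * A * C * t \<le> \<delta>\<^sup>2 / 4\<close>. The semigroup part uses the other three
    quarters of \<open>\<delta>\<^sup>2\<close>, as
    \<open>3 * (\<delta> / 2)\<^sup>2\<close>.\<close>
  define S0 where "S0 = min T (min (d / 2) (min (1 / (4 * C)) (\<delta>\<^sup>2 / (8 * A * C))))"
  have S0_pos: "0 < S0" using \<open>T > 0\<close> d C A \<delta> by (simp add: S0_def)
  have main: "integrable M (\<lambda>\<omega>. (infdist (X x t \<omega>) K)\<^sup>2) \<and> sqrt (\<integral>\<omega>. (infdist (X x t \<omega>) K)\<^sup>2 \<partial>M) \<le> \<delta>"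
    if t: "t \<in> {0..S0}" and x: "x \<in> K \<inter> ball x0 r" for t x
  proof -
    have tT: "0 \<le> t" "t \<le> T" using t by (auto simp: S0_def)
    have t1: "t \<le> d / 2" "t \<le> 1 / (4 * C)" "t \<le> \<delta>\<^sup>2 / (8 * A * C)" using t by (auto simp: S0_def)
    have small: "4 * C * t \<le> 1" using t1(2) C by (simp add: field_simps)
    have xr: "norm (x - x0) \<le> r" using x by (simp add: dist_norm norm_minus_commute)
    have xn: "norm x \<le> norm x0 + 1" using norm_triangle_ineq[of x0 "x - x0"] xr r by simp
    let ?A = "2 * (1 + norm x)\<^sup>2 + 6 * ((m + 1) * norm x)\<^sup>2"
    have A_le: "?A \<le> A" unfolding A_def using xn m by (intro add_mono mult_left_mono power_mono) auto
    \<comment> \<open>A limit along \<open>at_right 0\<close> is silent at 0 itself, so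
      \<open>t = 0\<close> is settled by \<open>S 0 = id_blinfun\<close>.\<close>
    have St0: "norm (S t x0 - x0) \<le> \<delta> / 4"
    proof (cases "t = 0")
      case True
      then show ?thesis using S0 \<delta> by simp
    next
      case False
      then show ?thesis using d(2)[of t] d(1) t1 tT by (simp add: dist_norm)
    qed
    \<comment> \<open>Strong continuity of the semigroup gives no rate uniform in the vector. It is
      therefore used at \<open>x0\<close> alone, and the difference \<open>x - x0\<close> is handled
      by the operator bound and the radius.\<close>
    have St1: "norm (S t (x - x0) - (x - x0)) \<le> \<delta> / 4"
    proof -
      have "norm (S t (x - x0) - (x - x0)) \<le> norm (S t) * norm (x - x0) + norm (x - x0)"
        using norm_triangle_ineq4[of "S t (x - x0)" "x - x0"] norm_blinfun[of "S t" "x - x0"] by simp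
      also have "\<dots> \<le> m * r + r" using m by (intro add_mono mult_mono S_le tT xr) auto
      also have "\<dots> \<le> \<delta> / 4" using mr by (simp add: distrib_right)
      finally show ?thesis .
    qed
    have dec: "(S t x0 - x0) + (S t (x - x0) - (x - x0)) = S t x - x" by (simp add: blinfun.diff_right)
    have "norm (S t x - x) \<le> norm (S t x0 - x0) + norm (S t (x - x0) - (x - x0))"
      using norm_triangle_ineq[of "S t x0 - x0" "S t (x - x0) - (x - x0)"] unfolding dec .
    then have "norm (S t x - x) \<le> \<delta> / 2" using St0 St1 by simp
    then have "(norm (S t x - x))\<^sup>2 \<le> (\<delta> / 2)\<^sup>2" by (intro power_mono) auto
    then have p: "3 * (norm (S t x - x))\<^sup>2 \<le> 3 / 4 * \<delta>\<^sup>2" by (simp add: power_divide)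
    have "2 * ?A * C * t \<le> 2 * A * C * (\<delta>\<^sup>2 / (8 * A * C))"
      using A_le A C t1 tT by (intro mult_mono) auto
    also have "\<dots> = \<delta>\<^sup>2 / 4" using A C by (simp add: field_simps)
    finally have le: "3 * (norm (S t x - x))\<^sup>2 + 2 * ?A * C * t \<le> \<delta>\<^sup>2" using p by simp
    have Xm[measurable]: "X x t \<in> borel_measurable M"
      using assms(22)[of x] tT measurable_from_subalg[OF F_subalgebra[OF tT], of "X x t" borel]
      by (simp add: mild_solution_def)
    have [measurable]: "(\<lambda>h. infdist h K) \<in> borel_measurable borel"
      by (intro borel_measurable_continuous_onI continuous_intros)
    have "(\<integral>\<^sup>+\<omega>. ennreal ((infdist (X x t \<omega>) K)\<^sup>2) \<partial>M) \<le> (\<integral>\<^sup>+\<omega>. ennreal ((norm (X x t \<omega> - x))\<^sup>2) \<partial>M)"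
    proof (intro nn_integral_mono ennreal_leI power_mono)
      show "infdist (X x t \<omega>) K \<le> norm (X x t \<omega> - x)" for \<omega>
        using infdist_le[of x K "X x t \<omega>"] x by (simp add: dist_norm)
    qed (rule infdist_nonneg)
    also have "\<dots> \<le> ennreal (3 * (norm (S t x - x))\<^sup>2 + 2 * ?A * C * t)"
      unfolding C_def
      by (rule mild_solution_displacement[OF assms(22) S_le \<alpha>_le a b(2,1) m tT]) (use small in \<open>simp_all add: C_def\<close>)
    also have "\<dots> \<le> ennreal (\<delta>\<^sup>2)" by (rule ennreal_leI[OF le])
    finally have bound: "(\<integral>\<^sup>+\<omega>. ennreal ((infdist (X x t \<omega>) K)\<^sup>2) \<partial>M) \<le> ennreal (\<delta>\<^sup>2)" .
    have int: "integrable M (\<lambda>\<omega>. (infdist (X x t \<omega>) K)\<^sup>2)"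
      by (rule integrableI_nonneg) (use bound in \<open>auto intro: le_less_trans\<close>)
    have "ennreal (\<integral>\<omega>. (infdist (X x t \<omega>) K)\<^sup>2 \<partial>M) \<le> ennreal (\<delta>\<^sup>2)"
      using bound nn_integral_eq_integral[OF int] by simp
    then have "(\<integral>\<omega>. (infdist (X x t \<omega>) K)\<^sup>2 \<partial>M) \<le> \<delta>\<^sup>2" by (simp add: ennreal_le_iff)
    then have "sqrt (\<integral>\<omega>. (infdist (X x t \<omega>) K)\<^sup>2 \<partial>M) \<le> \<delta>" using \<delta> by (intro real_le_lsqrt) auto
    with int show ?thesis by blast
  qed
  show "\<exists>S0\<in>{0<..T}. \<exists>V. open V \<and> x0 \<in> V \<and> (\<forall>t\<in>{0..S0}. \<forall>x\<in>K \<inter> V.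
      integrable M (\<lambda>\<omega>. (infdist (X x t \<omega>) K)\<^sup>2) \<and> sqrt (\<integral>\<omega>. (infdist (X x t \<omega>) K)\<^sup>2 \<partial>M) \<le> \<delta>)"
  proof (intro bexI exI conjI)
    show "\<forall>t\<in>{0..S0}. \<forall>x\<in>K \<inter> ball x0 r.
      integrable M (\<lambda>\<omega>. (infdist (X x t \<omega>) K)\<^sup>2) \<and> sqrt (\<integral>\<omega>. (infdist (X x t \<omega>) K)\<^sup>2 \<partial>M) \<le> \<delta>"
      using main by blast
    show "S0 \<in> {0<..T}" using S0_pos by (simp add: S0_def)
  qed (use r in auto)
qed

end
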